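(* Let $\mathcal{X}$ be a metrizable topological space, let $\mathcal{G}\subset\mathcal{F}(\mathcal{X})$ be a topologized set of real-valued measurable functions on $\mathcal{X}$, and let $\mathcal{M}(\mathcal{X})$ be equipped with the weak star topology. Let $\mathcal{A}\subset\mathcal{G}\times\mathcal{M}(\mathcal{X})$ be Suslin, let $\mathcal{Q}$ be a separable metrizable space, and let $\Psi:\mathcal{A}\to\mathcal{Q}$ be Borel measurable. Let $\Phi:\mathcal{A}\to\mathbb{R}$ be the quantity of interest, let $\mathfrak{D}$ be a set of data maps $\mathbb{D}:\mathcal{A}\to\mathcal{M}(\mathcal{D})$, where $\mathcal{D}$ is a metrizable data space with a fixed compatible metric, fix $d\in\mathcal{D}$, and let $B_\delta$ be the open ball of radius $\delta$ about $d$. Let $\mathfrak{Q}\subset\mathcal{M}(\mathcal{Q})$ be such that $\operatorname{supp}\mathbb{Q}\subset\Psi(\mathcal{A})$ for every $\mathbb{Q}\in\mathfrak{Q}$, and let $\tau\ge 0$. Suppose there exist $\mathbb{Q}\in\mathfrak{Q}$, $\mathbb{D}\in\mathfrak{D}$ and a continuous monotonically increasing function $h:\mathbb{R}^+\to\mathbb{R}$ with $h(0)=0$ such that $$\mathbb{Q}\Bigl(\bigl\{q:\ \inf_{(f,\mu)\in\Psi^{-1}(q)}\mathbb{D}(f,\mu)[B_\delta]\le\tau\bigr\}\Bigr)\ \ge\ 1-h(\delta),\qquad \delta>0 .$$ Fix $\delta>0$. If $\varepsilon\ge 0$, $\varepsilon'>0$ and $\delta'>0$ are real numbers such that (for these $\mathbb{Q},\mathbb{D}$)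 $$\mathbb{Q}\Bigl(\Bigl\{q:\ \sup_{(f,\mu)\in\Psi^{-1}(q),\ \mathbb{D}(f,\mu)[B_\delta]>\varepsilon}\Phi(f,\mu)\ >\ \sup_{(f,\mu)\in\mathcal{A}}\Phi(f,\mu)-\delta'\Bigr\}\Bigr)\ \ge\ \varepsilon'$$ and $$h(\delta)+\tau\ \le\ \frac{\varepsilon\,\delta'\,\varepsilon'}{\mathcal{U}(\mathcal{A})-\mathcal{L}(\mathcal{A})},$$ then $$\mathcal{U}(\mathcal{A})-2\delta'\ \le\ \mathcal{U}\bigl(\Psi^{-1}(\mathfrak{Q})\odot_{B_\delta}\mathfrak{D}\bigr)\ \le\ \mathcal{U}(\mathcal{A}).$$
   Context: For a topological space $\mathcal{Y}$, $\mathcal{M}(\mathcal{Y})$ denotes the set of Borel probability measures on $\mathcal{Y}$, and $\mathcal{F}(\mathcal{X})$ the real-valued measurable functions on $\mathcal{X}$. $\mathcal{G}\times\mathcal{M}(\mathcal{X})$ has the product topology. $\mathcal{U}(\mathcal{A}):=\sup_{(f,\mu)\in\mathcal{A}}\Phi(f,\mu)$ and $\mathcal{L}(\mathcal{A}):=\inf_{(f,\mu)\in\mathcal{A}}\Phi(f,\mu)$, assumed finite. When $\mathcal{U}(\mathcal{A})=\mathcal{L}(\mathcal{A})$ the condition involving the quotient is regarded as satisfied. The quantity of interest $\Phi$ is measurable, and for each data map $\mathbb{D}$ and Borel $B\subset\mathcal{D}$ the function $(f,\mu)\mapsto\mathbb{D}(f,\mu)[B]$ is measurable. Elements $\pi\in\mathcal{M}(\mathcal{A})$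 are called priors. $\Psi^{-1}(\mathfrak{Q}):=\{\pi\in\mathcal{M}(\mathcal{A}):\Psi_*\pi\in\mathfrak{Q}\}$, where $\Psi_*\pi$ is the push-forward, while for $q\in\mathcal{Q}$, $\Psi^{-1}(q)=\{(f,\mu)\in\mathcal{A}:\Psi(f,\mu)=q\}$. For a prior $\pi$, a data map $\mathbb{D}$ and an open $B\subset\mathcal{D}$, put $(\pi\cdot\mathbb{D})[B]:=\mathbb{E}_{(f,\mu)\sim\pi}[\mathbb{D}(f,\mu)[B]]$, and, when this is positive, $$\mathbb{E}_{\pi\odot\mathbb{D}}[\Phi\mid B]:=\frac{\mathbb{E}_{(f,\mu)\sim\pi}\bigl[\Phi(f,\mu)\,\mathbb{D}(f,\mu)[B]\bigr]}{\mathbb{E}_{(f,\mu)\sim\pi}\bigl[\mathbb{D}(f,\mu)[B]\bigr]}.$$ For a set $\Pi$ of priors, $\mathcal{U}(\Pi\odot_B\mathfrak{D}):=\sup\{\mathbb{E}_{\pi\odot\mathbb{D}}[\Phi\mid B]:\ \pi\in\Pi,\ \mathbb{D}\in\mathfrak{D},\ (\pi\cdot\mathbb{D})[B]>0\}$. Sets and functions of $q$ appearing in the statement are universally measurable; $\mathbb{Q}$ is extended to universally measurable sets in the usual way (by completion). *)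

theory Defs
  imports "HOL-Probability.Probability"
begin

definition borel_of :: "'a topology \<Rightarrow> 'a measure" where
  "borel_of T = sigma (topspace T) {U. openin T U}"

definition borel_probs :: "'a topology \<Rightarrow> 'a measure set" where
  "borel_probs T = {\<mu>. prob_space \<mu> \<and> sets \<mu> = sets (borel_of T)}"

lemma sets_borel_of_euclidean: "sets (borel_of (euclidean :: 'a::topological_space topology)) = sets borel"
  by (simp add: borel_of_def borel_def)

text \<open>The weak star topology on the Borel probability measures: the coarsest one for which
  integration against every bounded continuous function is continuous.  (Taking the function
  0 and the open set of all reals shows that the underlying set is all of
  the Borel probability measures.)\<close>

definition weak_star :: "'x::topological_space measure topology" where
  "weak_star = topology_generated_by
     {{\<mu> \<in> borel_probs euclidean. (\<integral>x. g x \<partial>\<mu>) \<in> U} | (g :: 'x \<Rightarrow> real) (U :: real set).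
        continuous_on UNIV g \<and> bounded (range g) \<and> open U}"

lemma topspace_weak_star:
  "topspace (weak_star :: 'x::topological_space measure topology) = borel_probs euclidean"
proof -
  let ?F = "{{\<mu> \<in> borel_probs euclidean. (\<integral>x. g x \<partial>\<mu>) \<in> U} | (g :: 'x \<Rightarrow> real) (U :: real set).
        continuous_on UNIV g \<and> bounded (range g) \<and> open U}"
  have "borel_probs euclidean \<in> ?F"
    by (intro CollectI exI[of _ "\<lambda>_. 0"] exI[of _ UNIV]) auto
  then have "\<Union>?F = borel_probs euclidean"
    by auto
  then show ?thesis
    unfolding weak_star_def topology_generated_by_topspace by simp
qed

text \<open>Suslin space: Hausdorff continuous image of a Polish space.  Polish spaces have at most the
  cardinality of the continuum, so up to homeomorphism all of them are topologies carried by some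
  set of reals; the type \<open>real topology\<close> (arbitrary carrier, arbitrary topology) thus loses no
  generality.\<close>

definition polish_space :: "'a topology \<Rightarrow> bool" where
  "polish_space P \<longleftrightarrow> completely_metrizable_space P \<and> separable_space P"

definition suslin_space :: "'a topology \<Rightarrow> bool" where
  "suslin_space T \<longleftrightarrow> Hausdorff_space T \<and>
     (\<exists>(P :: real topology) g. polish_space P \<and> continuous_map P T g \<and> g ` topspace P = topspace T)"

definition supp :: "'q::topological_space measure \<Rightarrow> 'q set" where
  "supp \<nu> = {q. \<forall>U. open U \<and> q \<in> U \<longrightarrow> 0 < measure \<nu> U}"

definition universally_measurable :: "('q::topological_space \<Rightarrow> ereal) \<Rightarrow> bool" where
  "universally_measurable g \<longleftrightarrow> (\<forall>\<nu>\<in>borel_probs euclidean. g \<in> borel_measurable (completion \<nu>))"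

text \<open>In what follows \<open>AT\<close> is the topological space of admissible pairs \<open>(f, \<mu>)\<close>; values
  of functions outside its underlying set are irrelevant.\<close>

type_synonym 'x scenario = "('x \<Rightarrow> real) \<times> 'x measure"

abbreviation scenario_topology ::
  "('x::topological_space \<Rightarrow> real) topology \<Rightarrow> 'x scenario set \<Rightarrow> 'x scenario topology" where
  "scenario_topology G A \<equiv> subtopology (prod_topology G weak_star) A"

definition data_map :: "'a topology \<Rightarrow> ('a \<Rightarrow> 'd::topological_space measure) \<Rightarrow> bool" where
  "data_map AT \<DD> \<longleftrightarrow> (\<forall>a\<in>topspace AT. \<DD> a \<in> borel_probs euclidean) \<and>
     (\<forall>B\<in>sets borel. (\<lambda>a. measure (\<DD> a) B) \<in> borel_measurable (borel_of AT))"

definition priors_over ::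
  "'a topology \<Rightarrow> ('a \<Rightarrow> 'q::topological_space) \<Rightarrow> 'q measure set \<Rightarrow> 'a measure set" where
  "priors_over AT \<Psi> \<QQ> = {\<pi> \<in> borel_probs AT. distr \<pi> borel \<Psi> \<in> \<QQ>}"

definition data_prob :: "'a measure \<Rightarrow> ('a \<Rightarrow> 'd measure) \<Rightarrow> 'd set \<Rightarrow> real" where
  "data_prob \<pi> \<DD> B = (\<integral>a. measure (\<DD> a) B \<partial>\<pi>)"

definition cond_exp_data :: "('a \<Rightarrow> real) \<Rightarrow> 'a measure \<Rightarrow> ('a \<Rightarrow> 'd measure) \<Rightarrow> 'd set \<Rightarrow> real" where
  "cond_exp_data \<Phi> \<pi> \<DD> B = (\<integral>a. \<Phi> a * measure (\<DD> a) B \<partial>\<pi>) / data_prob \<pi> \<DD> B"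

text \<open>Suprema and infima are taken in the extended reals, so that the supremum of the empty set is
  \<open>-\<infinity>\<close> and the infimum over an empty fibre is \<open>\<infinity>\<close>.\<close>

definition upper_val :: "('a \<Rightarrow> real) \<Rightarrow> 'a set \<Rightarrow> ereal" where
  "upper_val \<Phi> A = (SUP a\<in>A. ereal (\<Phi> a))"

definition lower_val :: "('a \<Rightarrow> real) \<Rightarrow> 'a set \<Rightarrow> ereal" where
  "lower_val \<Phi> A = (INF a\<in>A. ereal (\<Phi> a))"

definition upper_post ::
  "('a \<Rightarrow> real) \<Rightarrow> 'a measure set \<Rightarrow> ('a \<Rightarrow> 'd measure) set \<Rightarrow> 'd set \<Rightarrow> ereal" where
  "upper_post \<Phi> PR DM B =
     Sup {ereal (cond_exp_data \<Phi> \<pi> \<DD> B) | \<pi> \<DD>. \<pi> \<in> PR \<and> \<DD> \<in> DM \<and> 0 < data_prob \<pi> \<DD> B}"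

definition fibre :: "'a set \<Rightarrow> ('a \<Rightarrow> 'q) \<Rightarrow> 'q \<Rightarrow> 'a set" where
  "fibre A \<Psi> q = {a \<in> A. \<Psi> a = q}"

definition fibre_min_data ::
  "'a set \<Rightarrow> ('a \<Rightarrow> 'q) \<Rightarrow> ('a \<Rightarrow> 'd measure) \<Rightarrow> 'd set \<Rightarrow> 'q \<Rightarrow> ereal" where
  "fibre_min_data A \<Psi> \<DD> B q = (INF a\<in>fibre A \<Psi> q. ereal (measure (\<DD> a) B))"

definition fibre_sup ::
  "'a set \<Rightarrow> ('a \<Rightarrow> 'q) \<Rightarrow> ('a \<Rightarrow> real) \<Rightarrow> ('a \<Rightarrow> 'd measure) \<Rightarrow> 'd set \<Rightarrow> real \<Rightarrow> 'q \<Rightarrow> ereal" where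
  "fibre_sup A \<Psi> \<Phi> \<DD> B \<epsilon> q =
     (SUP a\<in>{a \<in> fibre A \<Psi> q. \<epsilon> < measure (\<DD> a) B}. ereal (\<Phi> a))"

end

theory Submission
  imports Defs
begin

text \<open>The upper bound says that a weighted mean of \<open>\<Phi>\<close> is at most its supremum
  (\<open>upper_post_le\<close>).  For the lower bound a prior \<open>\<pi>\<close> with \<open>\<Psi>\<close>-marginal \<open>Q\<close> is built as the
  image of \<open>Q\<close> under a section \<open>\<psi>\<close> of \<open>\<Psi>\<close>.  Write \<open>p a\<close> for the probability that the scenario
  \<open>a\<close> gives to the ball, and \<open>u\<close>, \<open>l\<close> for the supremum and the infimum of \<open>\<Phi>\<close>.  Over the set
  \<open>E\<^sub>1\<close> of those \<open>q\<close> whose fibre contains a scenario with \<open>\<Phi> > u - \<delta>'\<close> and \<open>p > \<epsilon>\<close> the section picks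
  such a scenario.  Elsewhere it makes the data as improbable as it can: over the
  set \<open>E\<^sub>2\<close> of those \<open>q\<close> whose fibre contains a scenario with \<open>p < \<tau> + \<eta>\<close> it picks one of these.
  Observing the ball then conditions the prior onto its part over \<open>E\<^sub>1\<close>: that part has weight
  \<open>c \<ge> \<epsilon> \<epsilon>'\<close>, the rest has weight at most \<open>\<tau> + \<eta> + h \<delta>\<close>, and each unit of the rest costs at most
  \<open>u - l\<close>.  So the conditional expectation falls short of \<open>u\<close> by at most
  \<open>\<delta>' + (u - l) (\<tau> + \<eta> + h \<delta>) / c\<close>, and the assumption on \<open>h \<delta> + \<tau>\<close> bounds this by
  \<open>2 \<delta>' + (u - l) \<eta> / c\<close>, where \<open>\<eta>\<close> is arbitrarily small
  (\<open>weighted_mean_lower_bound\<close>, \<open>near_optimal_prior\<close>).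

  The real work is to choose \<open>\<psi>\<close> measurably.  This is the selection theorem of Jankov and von
  Neumann for a Borel map on a Suslin space (\<open>borel_section_completion\<close>), proved here in the form
  needed for one fixed \<open>Q\<close>.  A Borel set in a Suslin space is the continuous image of a closed
  set \<open>W\<close> of number sequences, and \<open>W\<close> can be chosen so fine that it decides, locally
  constantly, membership in any given countable family of Borel sets
  (\<open>borel_sequence_parametrization\<close>).  Applied to the preimages of a countable base this makes
  the Borel map continuous on \<open>W\<close>.  Continuous images of closed sets of sequences are measurable
  for the completion of \<open>Q\<close> by Choquet's capacity argument (\<open>analytic_sets_completion\<close>), and
  therefore the lexicographically least point of each fibre is a measurable section
  (\<open>continuous_section_completion\<close>).\<close>

section \<open>The space of number sequences\<close>

definition agree :: "nat \<Rightarrow> (nat \<Rightarrow> nat) \<Rightarrow> (nat \<Rightarrow> nat) \<Rightarrow> bool" where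
  "agree n \<sigma> \<tau> \<longleftrightarrow> (\<forall>i<n. \<tau> i = \<sigma> i)"

lemma agree_refl [simp]: "agree n \<sigma> \<sigma>"
  and agree_sym: "agree n \<sigma> \<tau> \<Longrightarrow> agree n \<tau> \<sigma>"
  and agree_trans: "agree n \<sigma> \<tau> \<Longrightarrow> agree n \<tau> \<rho> \<Longrightarrow> agree n \<sigma> \<rho>"
  by (auto simp: agree_def)

lemma open_agree: "open {\<tau>. agree n \<sigma> \<tau>}"
proof -
  have "open {f :: nat \<Rightarrow> nat. \<forall>i\<in>{..<n}. f (id i) \<in> {\<sigma> i}}"
    by (rule product_topology_basis') (simp_all add: discrete_topology_class.open_discrete)
  also have "{f. \<forall>i\<in>{..<n}. f (id i) \<in> {\<sigma> i}} = {\<tau>. agree n \<sigma> \<tau>}"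
    by (auto simp: agree_def)
  finally show ?thesis .
qed

lemma open_nat_fun_iff:
  fixes U :: "(nat \<Rightarrow> nat) set"
  shows "open U \<longleftrightarrow> (\<forall>\<sigma>\<in>U. \<exists>n. \<forall>\<tau>. agree n \<sigma> \<tau> \<longrightarrow> \<tau> \<in> U)"
proof
  assume "open U"
  show "\<forall>\<sigma>\<in>U. \<exists>n. \<forall>\<tau>. agree n \<sigma> \<tau> \<longrightarrow> \<tau> \<in> U"
  proof
    fix \<sigma> assume "\<sigma> \<in> U"
    have "\<exists>X. \<sigma> \<in> (\<Pi>\<^sub>E i\<in>UNIV. X i) \<and> (\<forall>i. openin (euclidean :: nat topology) (X i)) \<and>
        finite {i. X i \<noteq> topspace (euclidean :: nat topology)} \<and> (\<Pi>\<^sub>E i\<in>UNIV. X i) \<subseteq> U"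
      using \<open>open U\<close> \<open>\<sigma> \<in> U\<close> unfolding open_fun_def
      by (rule product_topology_open_contains_basis)
    then obtain X where X: "\<sigma> \<in> (\<Pi>\<^sub>E i\<in>UNIV. X i)"
      "finite {i. X i \<noteq> topspace (euclidean :: nat topology)}" "(\<Pi>\<^sub>E i\<in>UNIV. X i) \<subseteq> U"
      by blast
    then obtain n where n: "\<And>i. X i \<noteq> UNIV \<Longrightarrow> i < n"
      by (auto simp: finite_nat_set_iff_bounded)
    have "\<tau> \<in> U" if "agree n \<sigma> \<tau>" for \<tau>
    proof -
      have "\<tau> i \<in> X i" for i
        using X(1) n[of i] that by (cases "X i = UNIV") (auto simp: agree_def PiE_iff)
      then show ?thesis using X(3) by auto
    qed
    then show "\<exists>n. \<forall>\<tau>. agree n \<sigma> \<tau> \<longrightarrow> \<tau> \<in> U" by blast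
  qed
next
  assume *: "\<forall>\<sigma>\<in>U. \<exists>n. \<forall>\<tau>. agree n \<sigma> \<tau> \<longrightarrow> \<tau> \<in> U"
  show "open U"
  proof (rule topological_space_class.openI)
    fix \<sigma> assume "\<sigma> \<in> U"
    with * obtain n where "\<forall>\<tau>. agree n \<sigma> \<tau> \<longrightarrow> \<tau> \<in> U" by blast
    then show "\<exists>T. open T \<and> \<sigma> \<in> T \<and> T \<subseteq> U"
      by (intro exI[of _ "{\<tau>. agree n \<sigma> \<tau>}"]) (auto intro: open_agree)
  qed
qed

lemma closed_nat_fun_iff:
  fixes W :: "(nat \<Rightarrow> nat) set"
  shows "closed W \<longleftrightarrow> (\<forall>\<sigma>. (\<forall>n. \<exists>\<tau>\<in>W. agree n \<sigma> \<tau>) \<longrightarrow> \<sigma> \<in> W)"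
  unfolding closed_def open_nat_fun_iff by blast

lemma openin_nat_fun_iff:
  fixes W :: "(nat \<Rightarrow> nat) set"
  shows "openin (top_of_set W) U \<longleftrightarrow> U \<subseteq> W \<and> (\<forall>\<sigma>\<in>U. \<exists>n. \<forall>\<tau>\<in>W. agree n \<sigma> \<tau> \<longrightarrow> \<tau> \<in> U)"
proof
  assume "openin (top_of_set W) U"
  then obtain O' where "open O'" "U = W \<inter> O'" by (auto simp: openin_open)
  then show "U \<subseteq> W \<and> (\<forall>\<sigma>\<in>U. \<exists>n. \<forall>\<tau>\<in>W. agree n \<sigma> \<tau> \<longrightarrow> \<tau> \<in> U)"
    unfolding open_nat_fun_iff by blast
next
  assume U: "U \<subseteq> W \<and> (\<forall>\<sigma>\<in>U. \<exists>n. \<forall>\<tau>\<in>W. agree n \<sigma> \<tau> \<longrightarrow> \<tau> \<in> U)"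
  show "openin (top_of_set W) U"
  proof (subst openin_subopen, intro ballI)
    fix \<sigma> assume "\<sigma> \<in> U"
    with U obtain n where "\<forall>\<tau>\<in>W. agree n \<sigma> \<tau> \<longrightarrow> \<tau> \<in> U" by blast
    moreover have "openin (top_of_set W) (W \<inter> {\<tau>. agree n \<sigma> \<tau>})"
      using open_agree by (auto intro: openin_open_Int)
    ultimately show "\<exists>T. openin (top_of_set W) T \<and> \<sigma> \<in> T \<and> T \<subseteq> U"
      using \<open>\<sigma> \<in> U\<close> U by (intro exI[of _ "W \<inter> {\<tau>. agree n \<sigma> \<tau>}"]) auto
  qed
qed

text \<open>A point of a complete separable space is coded by the index sequences of fast converging
  sequences in a countable dense set.  Fast convergence is demanded of consecutive terms, each
  instance of which involves two coordinates only, so the set of codes is closed; and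
  the limit of a code is known up to \<open>2 / 2^n\<close> from its first \<open>n + 1\<close> entries, so it depends
  continuously on the code.\<close>

lemma polish_space_baire_image:
  assumes "polish_space P"
  obtains Y :: "(nat \<Rightarrow> nat) set" and g where
    "closed Y" "continuous_map (top_of_set Y) P g" "g ` Y = topspace P"
proof -
  from assms obtain M d where "Metric_space M d" and mc: "Metric_space.mcomplete M d"
    and P: "P = Metric_space.mtopology M d"
    unfolding polish_space_def completely_metrizable_space_def by blast
  interpret Metric_space M d by fact
  obtain C where C: "countable C" "C \<subseteq> M" "mtopology closure_of C = M"
    using assms unfolding polish_space_def separable_space_def P by auto
  show thesis
  proof (cases "C = {}")
    case True
    then have "M = {}" using C(3) by simp
    then have "topspace P = {}" unfolding P topspace_mtopology .
    moreover have "continuous_map (top_of_set {}) P (\<lambda>_. undefined)"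
      by (simp add: continuous_map_def)
    ultimately show thesis by (intro that[of "{}" "\<lambda>_. undefined"]) auto
  next
    case False
    define x where "x = from_nat_into C"
    have xM: "x n \<in> M" for n
      using C(2) False by (metis from_nat_into subsetD x_def)
    have dense: "\<exists>n. d (x n) y < e" if "y \<in> M" "e > 0" for y e
    proof -
      have "y \<in> mtopology closure_of C" using C that by simp
      then obtain z where "z \<in> C" "z \<in> mball y e"
        unfolding metric_closure_of using \<open>e > 0\<close> by auto
      moreover obtain n where "z = x n"
        using \<open>z \<in> C\<close> C(1) False unfolding x_def by (metis from_nat_into_surj)
      ultimately show ?thesis by (auto simp: commute)
    qed
    define Y where "Y = {\<sigma>. \<forall>n. d (x (\<sigma> n)) (x (\<sigma> (Suc n))) \<le> (1/2)^n}"
    have "closed Y"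
      unfolding closed_nat_fun_iff
    proof safe
      fix \<sigma> assume *: "\<forall>n. \<exists>\<tau>\<in>Y. agree n \<sigma> \<tau>"
      show "\<sigma> \<in> Y" unfolding Y_def
      proof safe
        fix n
        obtain \<tau> where "\<tau> \<in> Y" "agree (Suc (Suc n)) \<sigma> \<tau>" using * by blast
        then have "\<tau> n = \<sigma> n" "\<tau> (Suc n) = \<sigma> (Suc n)" by (auto simp: agree_def)
        with \<open>\<tau> \<in> Y\<close> show "d (x (\<sigma> n)) (x (\<sigma> (Suc n))) \<le> (1/2)^n"
          unfolding Y_def mem_Collect_eq by metis
      qed
    qed
    have tail: "d (x (\<sigma> n)) (x (\<sigma> (n + k))) \<le> 2 * (1/2)^n - 2 * (1/2)^(n+k)" if "\<sigma> \<in> Y" for \<sigma> n k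
    proof (induction k)
      case (Suc k)
      have "d (x (\<sigma> n)) (x (\<sigma> (n + Suc k)))
        \<le> d (x (\<sigma> n)) (x (\<sigma> (n + k))) + d (x (\<sigma> (n+k))) (x (\<sigma> (Suc (n + k))))"
        using triangle xM by simp
      also have "\<dots> \<le> (2 * (1/2)^n - 2 * (1/2)^(n+k)) + (1/2)^(n+k)"
        using Suc that by (intro add_mono) (auto simp: Y_def)
      finally show ?case by simp
    qed (simp add: xM)
    have tail': "d (x (\<sigma> n)) (x (\<sigma> (n + k))) \<le> 2 * (1/2)^n" if "\<sigma> \<in> Y" for \<sigma> n k
      using tail[OF that, of n k] zero_le_power[of "1/2::real" "n+k"] by linarith
    have small: "\<exists>n. 2 * (1/2)^n < e" if "e > 0" for e :: real
      using real_arch_pow_inv[of "e/2" "1/2"] that by (auto simp: field_simps)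
    have cauchy: "MCauchy (\<lambda>n. x (\<sigma> n))" if "\<sigma> \<in> Y" for \<sigma>
      unfolding MCauchy_def
    proof safe
      fix e :: real assume "e > 0"
      then obtain n where n: "2 * (1/2)^n < e/2" using small[of "e/2"] by auto
      have "d (x (\<sigma> i)) (x (\<sigma> j)) < e" if "n \<le> i" "n \<le> j" for i j
      proof -
        have "d (x (\<sigma> n)) (x (\<sigma> i)) < e/2" "d (x (\<sigma> n)) (x (\<sigma> j)) < e/2"
          using n tail'[OF \<open>\<sigma> \<in> Y\<close>, of n "i - n"] tail'[OF \<open>\<sigma> \<in> Y\<close>, of n "j - n"] that by auto
        moreover have "d (x (\<sigma> i)) (x (\<sigma> j)) \<le> d (x (\<sigma> n)) (x (\<sigma> i)) + d (x (\<sigma> n)) (x (\<sigma> j))"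
          using triangle[of "x (\<sigma> i)" "x (\<sigma> n)" "x (\<sigma> j)"] xM by (simp add: commute)
        ultimately show ?thesis by linarith
      qed
      then show "\<exists>N. \<forall>n n'. N \<le> n \<longrightarrow> N \<le> n' \<longrightarrow> d (x (\<sigma> n)) (x (\<sigma> n')) < e" by blast
    qed (use xM in auto)
    define g where "g \<sigma> = (SOME l. limitin mtopology (\<lambda>n. x (\<sigma> n)) l sequentially)" for \<sigma>
    have lim: "limitin mtopology (\<lambda>n. x (\<sigma> n)) (g \<sigma>) sequentially" if "\<sigma> \<in> Y" for \<sigma>
      using cauchy[OF that] mc unfolding g_def mcomplete_def by (metis (mono_tags) someI_ex)
    have gM: "g \<sigma> \<in> M" if "\<sigma> \<in> Y" for \<sigma>
      using lim[OF that] by (simp add: limit_metric_sequentially)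
    have near: "d (x (\<sigma> n)) (g \<sigma>) \<le> 2 * (1/2)^n" if "\<sigma> \<in> Y" for \<sigma> n
    proof (rule field_le_epsilon)
      fix e :: real assume "e > 0"
      then obtain N where N: "\<And>k. k \<ge> N \<Longrightarrow> d (x (\<sigma> k)) (g \<sigma>) < e"
        using lim[OF \<open>\<sigma> \<in> Y\<close>] unfolding limit_metric_sequentially by blast
      have "d (x (\<sigma> n)) (g \<sigma>) \<le> d (x (\<sigma> n)) (x (\<sigma> (n + N))) + d (x (\<sigma> (n + N))) (g \<sigma>)"
        using triangle xM gM[OF that] by blast
      then show "d (x (\<sigma> n)) (g \<sigma>) \<le> 2 * (1/2)^n + e"
        using tail'[OF that, of n N] N[of "n + N"] by linarith
    qed
    have cont: "continuous_map (top_of_set Y) P g"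
      unfolding P continuous_map_to_metric
    proof (intro ballI allI impI)
      fix \<sigma> and e :: real assume "\<sigma> \<in> topspace (top_of_set Y)" "e > 0"
      then have \<sigma>: "\<sigma> \<in> Y" by simp
      obtain n where n: "2 * (1/2)^n < e/2" using small[of "e/2"] \<open>e > 0\<close> by auto
      have "g \<tau> \<in> mball (g \<sigma>) e" if "\<tau> \<in> Y" "agree (Suc n) \<sigma> \<tau>" for \<tau>
      proof -
        have "\<tau> n = \<sigma> n" using that by (auto simp: agree_def)
        then have "d (g \<sigma>) (g \<tau>) \<le> d (x (\<sigma> n)) (g \<sigma>) + d (x (\<tau> n)) (g \<tau>)"
          using triangle[of "g \<sigma>" "x (\<sigma> n)" "g \<tau>"] xM gM \<sigma> that by (simp add: commute)
        then show ?thesis using near[OF \<sigma>, of n] near[OF that(1), of n] n gM \<sigma> that by simp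
      qed
      then show "\<exists>U. openin (top_of_set Y) U \<and> \<sigma> \<in> U \<and> (\<forall>y\<in>U. g y \<in> mball (g \<sigma>) e)"
        using \<sigma> open_agree by (intro exI[of _ "Y \<inter> {\<tau>. agree (Suc n) \<sigma> \<tau>}"]) (auto intro: openin_open_Int)
    qed
    \<comment> \<open>Terms within \<open>(1/2)^k / 2\<close> of \<open>y\<close> have consecutive distances small enough for a code.\<close>
    have "y \<in> g ` Y" if "y \<in> M" for y
    proof -
      have "\<exists>n. d (x n) y < (1/2)^k / 2" for k by (rule dense[OF that]) simp
      then obtain \<sigma> where \<sigma>: "\<And>k. d (x (\<sigma> k)) y < (1/2)^k / 2" by metis
      have "\<sigma> \<in> Y" unfolding Y_def
      proof safe
        fix n
        have "d (x (\<sigma> n)) (x (\<sigma> (Suc n))) \<le> d (x (\<sigma> n)) y + d (x (\<sigma> (Suc n))) y"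
          using triangle[of "x (\<sigma> n)" y "x (\<sigma> (Suc n))"] xM that by (simp add: commute)
        moreover have "(1/2)^Suc n / 2 \<le> (1/2::real)^n / 2" by (simp add: field_simps)
        ultimately show "d (x (\<sigma> n)) (x (\<sigma> (Suc n))) \<le> (1/2)^n"
          using \<sigma>[of n] \<sigma>[of "Suc n"] by linarith
      qed
      have "limitin mtopology (\<lambda>n. x (\<sigma> n)) y sequentially"
        unfolding limit_metric_sequentially
      proof safe
        fix e :: real assume "e > 0"
        then obtain n where n: "2 * (1/2)^n < e" using small by blast
        have "d (x (\<sigma> k)) y < e" if "k \<ge> n" for k
        proof -
          have "(1/2::real)^k \<le> (1/2)^n" using that by (simp add: power_decreasing)
          moreover have "(0::real) \<le> (1/2)^k" by simp
          ultimately show ?thesis using \<sigma>[of k] n by linarith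
        qed
        then show "\<exists>N. \<forall>n\<ge>N. x (\<sigma> n) \<in> M \<and> d (x (\<sigma> n)) y < e" using xM by blast
      qed (fact that)
      then have "y = g \<sigma>"
        using lim[OF \<open>\<sigma> \<in> Y\<close>] limitin_metric_unique trivial_limit_sequentially by blast
      with \<open>\<sigma> \<in> Y\<close> show ?thesis by blast
    qed
    then have "g ` Y = topspace P" using gM P by auto
    with \<open>closed Y\<close> cont show thesis by (rule that)
  qed
qed

section \<open>Parametrizing Borel sets of a Suslin space\<close>

definition parametrizes :: "'a topology \<Rightarrow> (nat \<Rightarrow> nat) set \<Rightarrow> ((nat \<Rightarrow> nat) \<Rightarrow> 'a) \<Rightarrow> bool" where
  "parametrizes T W \<phi> \<longleftrightarrow> closed W \<and> continuous_map (top_of_set W) T \<phi> \<and> \<phi> ` W = topspace T"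

text \<open>On \<open>W\<close> this says that the preimage of \<open>X\<close> is clopen; the form with initial segments is the
  one that the constructions below produce.\<close>

definition locally_decides :: "(nat \<Rightarrow> nat) set \<Rightarrow> ((nat \<Rightarrow> nat) \<Rightarrow> 'a) \<Rightarrow> 'a set \<Rightarrow> bool" where
  "locally_decides W \<phi> X \<longleftrightarrow>
     (\<forall>\<sigma>\<in>W. \<exists>n. \<forall>\<tau>\<in>W. agree n \<sigma> \<tau> \<longrightarrow> (\<phi> \<tau> \<in> X \<longleftrightarrow> \<phi> \<sigma> \<in> X))"

lemma suslin_space_parametrizes:
  assumes "suslin_space T"
  obtains W \<phi> where "parametrizes T W \<phi>"
proof -
  obtain P :: "real topology" and g where P: "polish_space P" "continuous_map P T g" "g ` topspace P = topspace T"
    using assms unfolding suslin_space_def by blast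
  obtain Y :: "(nat \<Rightarrow> nat) set" and h
    where Y: "closed Y" "continuous_map (top_of_set Y) P h" "h ` Y = topspace P"
    by (rule polish_space_baire_image[OF P(1)])
  have "continuous_map (top_of_set Y) T (g \<circ> h)"
    using Y(2) P(2) by (rule continuous_map_compose)
  moreover have "(g \<circ> h) ` Y = topspace T"
    using Y(3) P(3) by (simp only: image_comp[symmetric])
  ultimately have "parametrizes T Y (g \<circ> h)"
    using Y(1) unfolding parametrizes_def by blast
  then show thesis by (rule that)
qed

text \<open>An open set of sequences is a union of cylinders, hence becomes clopen once every sequence
  carries a certificate.  A new first entry \<open>Suc n\<close> certifies that the first \<open>n\<close> entries of the
  tail force membership in \<open>X\<close>, and a new first entry \<open>0\<close> certifies that the tail lies outside
  the preimage of \<open>X\<close>.  Both conditions are closed for a fixed first entry.\<close>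

lemma refine_parametrization:
  assumes W: "parametrizes T W \<phi>" and X: "openin (top_of_set W) {\<sigma>\<in>W. \<phi> \<sigma> \<in> X}"
  obtains W' \<phi>' where "parametrizes T W' \<phi>'" "locally_decides W' \<phi>' X"
proof -
  define tl :: "(nat \<Rightarrow> nat) \<Rightarrow> nat \<Rightarrow> nat" where "tl \<sigma> i = \<sigma> (Suc i)" for \<sigma> i
  define inX where "inX n \<sigma> \<longleftrightarrow> (\<forall>\<tau>\<in>W. agree n \<sigma> \<tau> \<longrightarrow> \<phi> \<tau> \<in> X)" for n \<sigma>
  define W' where "W' = {\<sigma>. tl \<sigma> \<in> W \<and> (case \<sigma> 0 of 0 \<Rightarrow> \<phi> (tl \<sigma>) \<notin> X | Suc n \<Rightarrow> inX n (tl \<sigma>))}"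
  have tl: "agree n (tl \<sigma>) (tl \<tau>)" if "agree (Suc n) \<sigma> \<tau>" for n \<sigma> \<tau>
    using that by (auto simp: agree_def tl_def)
  have head: "\<tau> 0 = \<sigma> 0" if "agree (Suc n) \<sigma> \<tau>" for n \<sigma> \<tau>
    using that by (auto simp: agree_def)
  have opn: "\<exists>n. inX n \<sigma>" if "\<sigma> \<in> W" "\<phi> \<sigma> \<in> X" for \<sigma>
    using X that unfolding openin_nat_fun_iff inX_def by blast
  have clW: "closed W" using W by (simp add: parametrizes_def)
  have "closed W'"
    unfolding closed_nat_fun_iff
  proof (intro allI impI)
    fix \<sigma> assume *: "\<forall>n. \<exists>\<tau>\<in>W'. agree n \<sigma> \<tau>"
    have "\<exists>\<tau>\<in>W. agree n (tl \<sigma>) \<tau>" for n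
      using *[rule_format, of "Suc n"] tl by (auto simp: W'_def)
    with clW have \<sigma>W: "tl \<sigma> \<in> W" unfolding closed_nat_fun_iff by blast
    show "\<sigma> \<in> W'"
    proof (cases "\<sigma> 0")
      case 0
      have "\<phi> (tl \<sigma>) \<notin> X"
      proof
        assume "\<phi> (tl \<sigma>) \<in> X"
        then obtain n where n: "inX n (tl \<sigma>)" using opn \<sigma>W by blast
        obtain \<tau> where \<tau>: "\<tau> \<in> W'" "agree (Suc n) \<sigma> \<tau>" using * by blast
        then have "\<phi> (tl \<tau>) \<in> X" "\<tau> 0 = 0"
          using n tl[OF \<tau>(2)] head[OF \<tau>(2)] 0 by (auto simp: inX_def W'_def)
        with \<tau>(1) show False by (simp add: W'_def)
      qed
      with 0 \<sigma>W show ?thesis by (simp add: W'_def)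
    next
      case (Suc n)
      obtain \<tau> where \<tau>: "\<tau> \<in> W'" "agree (Suc n) \<sigma> \<tau>" using * by blast
      then have "inX n (tl \<tau>)" using head[OF \<tau>(2)] Suc by (simp add: W'_def)
      then have "inX n (tl \<sigma>)"
        unfolding inX_def using agree_trans agree_sym tl[OF \<tau>(2)] by blast
      with Suc \<sigma>W show ?thesis by (simp add: W'_def)
    qed
  qed
  moreover have "continuous_map (top_of_set W') T (\<phi> \<circ> tl)"
  proof (rule continuous_map_compose)
    have "continuous_on W' tl"
      unfolding tl_def
      by (intro continuous_on_coordinatewise_then_product continuous_on_subset[OF continuous_on_product_coordinates]) auto
    then show "continuous_map (top_of_set W') (top_of_set W) tl"
      by (auto simp: W'_def)
    show "continuous_map (top_of_set W) T \<phi>" using W by (simp add: parametrizes_def)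
  qed
  moreover have "(\<phi> \<circ> tl) ` W' = topspace T"
  proof -
    have "\<exists>\<sigma>'\<in>W'. tl \<sigma>' = \<sigma>" if "\<sigma> \<in> W" for \<sigma>
    proof (cases "\<phi> \<sigma> \<in> X")
      case True
      then obtain n where "inX n \<sigma>" using opn \<open>\<sigma> \<in> W\<close> by blast
      moreover have "tl (case_nat (Suc n) \<sigma>) = \<sigma>" by (simp add: tl_def fun_eq_iff)
      ultimately show ?thesis
        using \<open>\<sigma> \<in> W\<close> by (intro bexI[of _ "case_nat (Suc n) \<sigma>"]) (simp_all add: W'_def)
    next
      case False
      moreover have "tl (case_nat 0 \<sigma>) = \<sigma>" by (simp add: tl_def fun_eq_iff)
      ultimately show ?thesis
        using \<open>\<sigma> \<in> W\<close> by (intro bexI[of _ "case_nat 0 \<sigma>"]) (simp_all add: W'_def)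
    qed
    then have "tl ` W' = W" by (force simp: W'_def)
    then show ?thesis using W by (simp only: parametrizes_def image_comp[symmetric])
  qed
  moreover have "locally_decides W' (\<phi> \<circ> tl) X"
    unfolding locally_decides_def
  proof
    fix \<sigma> assume "\<sigma> \<in> W'"
    have "(\<phi> (tl \<tau>) \<in> X) = (\<tau> 0 \<noteq> 0)" if "\<tau> \<in> W'" for \<tau>
      using that by (auto simp: W'_def inX_def split: nat.splits)
    then show "\<exists>n. \<forall>\<tau>\<in>W'. agree n \<sigma> \<tau> \<longrightarrow> ((\<phi> \<circ> tl) \<tau> \<in> X) = ((\<phi> \<circ> tl) \<sigma> \<in> X)"
      using \<open>\<sigma> \<in> W'\<close> by (intro exI[of _ "Suc 0"]) (auto dest: head)
  qed
  ultimately show thesis using that[of W' "\<phi> \<circ> tl"] unfolding parametrizes_def by blast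
qed

text \<open>The common refinement is the fibre product over \<open>T\<close>: all sequences of codes, one from each
  parametrization, for the same point.  It is closed because \<open>T\<close> is Hausdorff.  A sequence of
  sequences is read off from a single one by pairing indices.\<close>

lemma common_parametrization:
  assumes T: "Hausdorff_space T"
    and W: "\<And>n::nat. parametrizes T (W n) (\<phi> n)" and X: "\<And>n. locally_decides (W n) (\<phi> n) (X n)"
  obtains W' \<phi>' where "parametrizes T W' \<phi>'" "\<And>n. locally_decides W' \<phi>' (X n)"
proof -
  define row :: "nat \<Rightarrow> (nat \<Rightarrow> nat) \<Rightarrow> nat \<Rightarrow> nat" where "row n \<sigma> i = \<sigma> (prod_encode (n, i))" for n \<sigma> i
  define W1 where "W1 = {\<sigma>. \<forall>n. row n \<sigma> \<in> W n}"
  define W' where "W' = {\<sigma>\<in>W1. \<forall>n. \<phi> n (row n \<sigma>) = \<phi> 0 (row 0 \<sigma>)}"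
  have cont_row: "continuous_on S (row n)" for S n
    unfolding row_def
    by (intro continuous_on_coordinatewise_then_product continuous_on_subset[OF continuous_on_product_coordinates]) auto
  have W1_alt: "W1 = (\<Inter>n. row n -` W n)" by (auto simp: W1_def)
  have "closed W1"
    unfolding W1_alt using W cont_row[of UNIV]
    by (intro closed_INT ballI closed_vimage) (auto simp: parametrizes_def)
  have cont: "continuous_map (top_of_set W1) T (\<lambda>\<sigma>. \<phi> n (row n \<sigma>))" for n
  proof -
    have "continuous_map (top_of_set W1) (top_of_set (W n)) (row n)"
      using cont_row[of W1 n] by (auto simp: W1_def)
    then have "continuous_map (top_of_set W1) T (\<phi> n \<circ> row n)"
      by (rule continuous_map_compose) (use W in \<open>simp add: parametrizes_def\<close>)
    then show ?thesis by (simp add: comp_def)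
  qed
  have W'_alt: "W' = W1 \<inter> (\<Inter>n. {\<sigma> \<in> topspace (top_of_set W1). \<phi> n (row n \<sigma>) = \<phi> 0 (row 0 \<sigma>)})"
    by (auto simp: W'_def)
  have "closedin (top_of_set W1) W'"
    unfolding W'_alt
    by (intro closedin_Int closedin_INT closedin_continuous_maps_eq[OF T] cont) auto
  then have "closed W'" using \<open>closed W1\<close> by (rule closedin_closed_trans)
  moreover have "continuous_map (top_of_set W') T (\<lambda>\<sigma>. \<phi> 0 (row 0 \<sigma>))"
    using continuous_map_from_subtopology[OF cont[of 0], of W'] by (auto simp: subtopology_subtopology W'_def Int_absorb1)
  moreover have "(\<lambda>\<sigma>. \<phi> 0 (row 0 \<sigma>)) ` W' = topspace T"
  proof
    show "(\<lambda>\<sigma>. \<phi> 0 (row 0 \<sigma>)) ` W' \<subseteq> topspace T"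
      using W[of 0] by (auto simp: W'_def W1_def parametrizes_def)
    show "topspace T \<subseteq> (\<lambda>\<sigma>. \<phi> 0 (row 0 \<sigma>)) ` W'"
    proof
      fix t assume "t \<in> topspace T"
      then have "\<exists>\<sigma>. \<sigma> \<in> W n \<and> \<phi> n \<sigma> = t" for n
        using W[of n] unfolding parametrizes_def by (metis imageE)
      then obtain \<sigma> where \<sigma>: "\<And>n. \<sigma> n \<in> W n" "\<And>n. \<phi> n (\<sigma> n) = t" by metis
      define \<rho> where "\<rho> k = (case prod_decode k of (n, i) \<Rightarrow> \<sigma> n i)" for k
      have "row n \<rho> = \<sigma> n" for n by (simp add: row_def \<rho>_def fun_eq_iff)
      then show "t \<in> (\<lambda>\<sigma>. \<phi> 0 (row 0 \<sigma>)) ` W'"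
        using \<sigma> by (intro image_eqI[of _ _ \<rho>]) (simp_all add: W'_def W1_def)
    qed
  qed
  moreover have "locally_decides W' (\<lambda>\<sigma>. \<phi> 0 (row 0 \<sigma>)) (X n)" for n
    unfolding locally_decides_def
  proof
    fix \<sigma> assume \<sigma>: "\<sigma> \<in> W'"
    then have "row n \<sigma> \<in> W n" by (simp add: W'_def W1_def)
    with X[of n] obtain k where k: "\<And>\<tau>. \<tau> \<in> W n \<Longrightarrow> agree k (row n \<sigma>) \<tau> \<Longrightarrow> (\<phi> n \<tau> \<in> X n) = (\<phi> n (row n \<sigma>) \<in> X n)"
      unfolding locally_decides_def by blast
    obtain K where K: "\<And>i. i < k \<Longrightarrow> prod_encode (n, i) < K"
      using finite_nat_set_iff_bounded[of "(\<lambda>i. prod_encode (n, i)) ` {..<k}"] by auto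
    have "(\<phi> 0 (row 0 \<tau>) \<in> X n) = (\<phi> 0 (row 0 \<sigma>) \<in> X n)" if "\<tau> \<in> W'" "agree K \<sigma> \<tau>" for \<tau>
    proof -
      have "agree k (row n \<sigma>) (row n \<tau>)"
        using that(2) K by (auto simp: agree_def row_def)
      moreover have "row n \<tau> \<in> W n" using that by (simp add: W'_def W1_def)
      ultimately have "(\<phi> n (row n \<tau>) \<in> X n) = (\<phi> n (row n \<sigma>) \<in> X n)" by (rule k[rotated])
      moreover have "\<phi> n (row n \<tau>) = \<phi> 0 (row 0 \<tau>)" "\<phi> n (row n \<sigma>) = \<phi> 0 (row 0 \<sigma>)"
        using that(1) \<sigma> by (auto simp: W'_def)
      ultimately show ?thesis by simp
    qed
    then show "\<exists>n'. \<forall>\<tau>\<in>W'. agree n' \<sigma> \<tau> \<longrightarrow> (\<phi> 0 (row 0 \<tau>) \<in> X n) = (\<phi> 0 (row 0 \<sigma>) \<in> X n)"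
      by blast
  qed
  ultimately show thesis using that[of W' "\<lambda>\<sigma>. \<phi> 0 (row 0 \<sigma>)"] unfolding parametrizes_def by blast
qed

text \<open>The sets that can be decided form a \<open>\<sigma>\<close>-algebra: a complement is decided by the same
  parametrization, and a countable union has an open preimage under a common refinement, which a
  further refinement makes clopen.\<close>

lemma borel_parametrization:
  assumes T: "suslin_space T" and X: "X \<in> sets (borel_of T)"
  shows "\<exists>W \<phi>. parametrizes T W \<phi> \<and> locally_decides W \<phi> X"
proof -
  have H: "Hausdorff_space T" using T by (simp add: suslin_space_def)
  obtain W0 \<phi>0 where W0: "parametrizes T W0 \<phi>0" using T by (rule suslin_space_parametrizes)
  have "{U. openin T U} \<subseteq> Pow (topspace T)" by (auto dest: openin_subset)
  with X have "X \<in> sigma_sets (topspace T) {U. openin T U}"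
    by (simp add: borel_of_def)
  then show ?thesis
  proof induction
    case (Basic U)
    then have "openin (top_of_set W0) {\<sigma> \<in> topspace (top_of_set W0). \<phi>0 \<sigma> \<in> U}"
      using W0 by (intro openin_continuous_map_preimage) (auto simp: parametrizes_def)
    then have "openin (top_of_set W0) {\<sigma>\<in>W0. \<phi>0 \<sigma> \<in> U}" by simp
    then obtain W \<phi> where "parametrizes T W \<phi>" "locally_decides W \<phi> U"
      by (rule refine_parametrization[OF W0])
    then show ?case by blast
  next
    case Empty
    show ?case using W0 by (intro exI[of _ W0] exI[of _ \<phi>0]) (auto simp: locally_decides_def)
  next
    case (Compl X)
    then obtain W \<phi> where W: "parametrizes T W \<phi>" "locally_decides W \<phi> X" by blast
    have "\<phi> \<sigma> \<in> topspace T" if "\<sigma> \<in> W" for \<sigma>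
      using W(1) that by (auto simp: parametrizes_def)
    with W(2) have "locally_decides W \<phi> (topspace T - X)"
      unfolding locally_decides_def by simp
    with W(1) show ?case by blast
  next
    case (Union X)
    then obtain W \<phi> where "\<And>n::nat. parametrizes T (W n) (\<phi> n) \<and> locally_decides (W n) (\<phi> n) (X n)"
      by metis
    then obtain W' \<phi>' where W': "parametrizes T W' \<phi>'" "\<And>n. locally_decides W' \<phi>' (X n)"
      using common_parametrization[OF H, of W \<phi> X] by metis
    have "openin (top_of_set W') {\<sigma>\<in>W'. \<phi>' \<sigma> \<in> (\<Union>n. X n)}"
      unfolding openin_nat_fun_iff
    proof safe
      fix \<sigma> n assume \<sigma>: "\<sigma> \<in> W'" "\<phi>' \<sigma> \<in> X n"
      with W'(2)[of n] obtain k where k: "\<forall>\<tau>\<in>W'. agree k \<sigma> \<tau> \<longrightarrow> (\<phi>' \<tau> \<in> X n) = (\<phi>' \<sigma> \<in> X n)"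
        unfolding locally_decides_def by blast
      show "\<exists>k. \<forall>\<tau>\<in>W'. agree k \<sigma> \<tau> \<longrightarrow> \<tau> \<in> {\<sigma>\<in>W'. \<phi>' \<sigma> \<in> (\<Union>n. X n)}"
      proof (intro exI[of _ k] ballI impI)
        fix \<tau> assume "\<tau> \<in> W'" "agree k \<sigma> \<tau>"
        with k \<sigma>(2) show "\<tau> \<in> {\<sigma>\<in>W'. \<phi>' \<sigma> \<in> (\<Union>n. X n)}" by blast
      qed
    qed
    then obtain W'' \<phi>'' where "parametrizes T W'' \<phi>''" "locally_decides W'' \<phi>'' (\<Union>n. X n)"
      by (rule refine_parametrization[OF W'(1)])
    then show ?case by blast
  qed
qed

lemma borel_sequence_parametrization:
  assumes T: "suslin_space T" and X: "\<And>n::nat. X n \<in> sets (borel_of T)"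
  obtains W \<phi> where "parametrizes T W \<phi>" "\<And>n. locally_decides W \<phi> (X n)"
proof -
  have "\<exists>W \<phi>. parametrizes T W \<phi> \<and> locally_decides W \<phi> (X n)" for n
    by (rule borel_parametrization[OF T X])
  then obtain W \<phi> where "\<And>n::nat. parametrizes T (W n) (\<phi> n) \<and> locally_decides (W n) (\<phi> n) (X n)"
    by metis
  moreover have "Hausdorff_space T" using T by (simp add: suslin_space_def)
  ultimately obtain W' \<phi>' where "parametrizes T W' \<phi>'" "\<And>n. locally_decides W' \<phi>' (X n)"
    using common_parametrization[of T W \<phi> X] by metis
  then show thesis by (rule that)
qed

section \<open>Continuous images: measurability and sections\<close>

lemma compact_box: "compact {\<sigma> :: nat \<Rightarrow> nat. \<forall>i. \<sigma> i \<le> m i}"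
proof -
  have "compactin (product_topology (\<lambda>_. euclidean :: nat topology) UNIV) (\<Pi>\<^sub>E i\<in>UNIV. {..m i})"
    by (simp add: compactin_PiE finite_imp_compact)
  moreover have "(\<Pi>\<^sub>E i\<in>UNIV. {..m i}) = {\<sigma>. \<forall>i. \<sigma> i \<le> m i}" by (auto simp: PiE_iff)
  ultimately show ?thesis by (simp add: euclidean_product_topology)
qed

lemma closed_box: "closed {\<sigma> :: nat \<Rightarrow> nat. \<forall>i<k. \<sigma> i \<le> m i}"
  unfolding closed_nat_fun_iff
proof (intro allI impI CollectI)
  fix \<sigma> i assume *: "\<forall>n. \<exists>\<tau>\<in>{\<sigma>. \<forall>i<k. \<sigma> i \<le> m i}. agree n \<sigma> \<tau>" and "i < k"
  obtain \<tau> where "\<tau> \<in> {\<sigma>. \<forall>i<k. \<sigma> i \<le> m i}" "agree (Suc i) \<sigma> \<tau>" using * by blast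
  with \<open>i < k\<close> show "\<sigma> i \<le> m i" by (auto simp: agree_def dest: spec[of _ i])
qed

text \<open>Compactness of the box \<open>{\<sigma>. \<forall>i. \<sigma> i \<le> m i}\<close> reaches the larger sets in which only the first
  \<open>k\<close> coordinates are bounded, although these are not compact.\<close>

lemma box_tube:
  fixes V :: "(nat \<Rightarrow> nat) set" and m :: "nat \<Rightarrow> nat"
  assumes V: "closed V" and disj: "\<And>\<sigma>. \<sigma> \<in> V \<Longrightarrow> \<not> (\<forall>i. \<sigma> i \<le> m i)"
  shows "\<exists>k. \<forall>\<sigma>\<in>V. \<not> (\<forall>i<k. \<sigma> i \<le> m i)"
proof (rule ccontr)
  assume "\<not> ?thesis"
  then have "\<forall>k. \<exists>\<sigma>. \<sigma> \<in> V \<and> (\<forall>i<k. \<sigma> i \<le> m i)" by blast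
  then obtain \<sigma> where \<sigma>: "\<And>k. \<sigma> k \<in> V" "\<And>k i. i < k \<Longrightarrow> \<sigma> k i \<le> m i" by metis
  \<comment> \<open>The \<open>i\<close>-th coordinates of \<open>\<sigma> k\<close> are bounded by \<open>m i\<close> except for the finitely many \<open>k \<le> i\<close>,
    so a single compact box contains all counterexamples.\<close>
  define M where "M i = m i + (\<Sum>k\<le>i. \<sigma> k i)" for i
  have \<sigma>M: "\<sigma> k i \<le> M i" for k i
  proof (cases "i < k")
    case False
    then have "\<sigma> k i \<le> (\<Sum>k\<le>i. \<sigma> k i)" by (intro member_le_sum) auto
    then show ?thesis by (simp add: M_def)
  qed (use \<sigma>(2)[of i k] in \<open>simp add: M_def\<close>)
  define B where "B k = {\<sigma> :: nat \<Rightarrow> nat. \<forall>i<k. \<sigma> i \<le> m i}" for k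
  have "compact ({\<sigma>. \<forall>i. \<sigma> i \<le> M i} \<inter> V)"
    using compact_box V by (rule compact_Int_closed)
  moreover have "{\<sigma>. \<forall>i. \<sigma> i \<le> M i} \<inter> V \<subseteq> (\<Union>k\<in>UNIV. - B k)"
  proof
    fix \<rho> assume "\<rho> \<in> {\<sigma>. \<forall>i. \<sigma> i \<le> M i} \<inter> V"
    then obtain i where "\<not> \<rho> i \<le> m i" using disj by blast
    then have "\<rho> \<in> - B (Suc i)" by (auto simp: B_def)
    then show "\<rho> \<in> (\<Union>k\<in>UNIV. - B k)" by blast
  qed
  moreover have "open (- B k)" for k unfolding B_def using closed_box by (rule open_Compl)
  ultimately obtain D where D: "finite D" "{\<sigma>. \<forall>i. \<sigma> i \<le> M i} \<inter> V \<subseteq> (\<Union>k\<in>D. - B k)"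
    using compactE_image[of "{\<sigma>. \<forall>i. \<sigma> i \<le> M i} \<inter> V" UNIV "\<lambda>k. - B k"] by metis
  then obtain N where N: "\<And>k. k \<in> D \<Longrightarrow> k < N" by (metis finite_nat_set_iff_bounded)
  have "\<sigma> N \<in> {\<sigma>. \<forall>i. \<sigma> i \<le> M i} \<inter> V" using \<sigma>M \<sigma>(1) by blast
  then obtain k where "k \<in> D" "\<sigma> N \<notin> B k" using D(2) by blast
  then show False using N[of k] \<sigma>(2)[of _ N] by (force simp: B_def)
qed

text \<open>Choquet's argument.  Outer measure is continuous along increasing unions of arbitrary sets,
  so bounding the coordinates one after the other keeps the outer measure of the image above \<open>c\<close>.
  The sequences obeying all the bounds form a compact set \<open>K\<close>, and by \<open>box_tube\<close> each
  neighbourhood of \<open>F ` K\<close> contains one of the earlier images, so its measure exceeds \<open>c\<close>.  In a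
  metrizable space \<open>F ` K\<close> is the intersection of a decreasing sequence of such neighbourhoods.\<close>

lemma analytic_inner_approximation:
  fixes F :: "(nat \<Rightarrow> nat) \<Rightarrow> 'q::topological_space"
  assumes met: "metrizable_space (euclidean :: 'q topology)"
    and W: "closed W" and F: "continuous_on W F"
    and Q: "finite_measure Q" "sets Q = sets borel"
    and c: "c < outer_measure_of Q (F ` W)"
  shows "\<exists>K\<in>sets Q. K \<subseteq> F ` W \<and> c \<le> emeasure Q K"
proof -
  have spQ: "space Q = UNIV" using Q(2) sets_eq_imp_space_eq[of Q borel] by simp
  have "\<exists>S. \<forall>k::nat. ((k = 0 \<longrightarrow> S k = W) \<and> c < outer_measure_of Q (F ` S k))
      \<and> (\<exists>j. S (Suc k) = {\<sigma> \<in> S k. \<sigma> k \<le> j})"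
  proof (rule dependent_nat_choice[where P = "\<lambda>k S. (k = 0 \<longrightarrow> S = W) \<and> c < outer_measure_of Q (F ` S)"
        and Q = "\<lambda>k S S'. \<exists>j. S' = {\<sigma> \<in> S. \<sigma> k \<le> j}"])
    show "\<exists>S. ((0::nat) = 0 \<longrightarrow> S = W) \<and> c < outer_measure_of Q (F ` S)" using c by auto
  next
    fix S and k :: nat assume S: "(k = 0 \<longrightarrow> S = W) \<and> c < outer_measure_of Q (F ` S)"
    define A where "A j = F ` {\<sigma> \<in> S. \<sigma> k \<le> j}" for j
    have "(SUP j. outer_measure_of Q (A j)) = outer_measure_of Q (\<Union>j. A j)"
      by (rule SUP_outer_measure_of_incseq) (auto simp: spQ A_def incseq_def)
    also have "(\<Union>j. A j) = F ` S" by (auto simp: A_def)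
    finally obtain j where "c < outer_measure_of Q (A j)"
      using S by (metis less_SUP_iff)
    then show "\<exists>S'. ((Suc k = 0 \<longrightarrow> S' = W) \<and> c < outer_measure_of Q (F ` S')) \<and> (\<exists>j. S' = {\<sigma> \<in> S. \<sigma> k \<le> j})"
      unfolding A_def by auto
  qed
  then obtain S where S0: "S 0 = W" and Sc: "\<And>k::nat. c < outer_measure_of Q (F ` S k)"
    and "\<forall>k. \<exists>j. S (Suc k) = {\<sigma> \<in> S k. \<sigma> k \<le> j}" by blast
  then obtain m where m: "\<And>k. S (Suc k) = {\<sigma> \<in> S k. \<sigma> k \<le> m k}" by metis
  have S: "S k = {\<sigma> \<in> W. \<forall>i<k. \<sigma> i \<le> m i}" for k
    by (induction k) (auto simp: S0 m less_Suc_eq)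
  define K where "K = W \<inter> {\<sigma>. \<forall>i. \<sigma> i \<le> m i}"
  have "compact K"
    unfolding K_def using compact_box W by (subst Int_commute) (rule compact_Int_closed)
  moreover have "continuous_on K F" using F by (rule continuous_on_subset) (auto simp: K_def)
  ultimately have "compact (F ` K)" by (rule compact_continuous_image[rotated])
  then have cl: "closedin euclidean (F ` K)"
    using met by (intro compactin_imp_closedin metrizable_imp_Hausdorff_space) auto
  then obtain C where C: "\<And>n. open (C n)" "\<And>n. C (Suc n) \<subseteq> C n" "(\<Inter>n. C n) = F ` K"
    using closed_imp_gdelta_in[OF met cl] unfolding gdelta_in_descending by auto
  have "c \<le> emeasure Q (C n)" for n
  proof -
    have "openin (top_of_set W) (W \<inter> F -` C n)"
      using F C(1) by (rule continuous_openin_preimage_gen)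
    then obtain G where G: "open G" "W \<inter> F -` C n = W \<inter> G" by (auto simp: openin_open)
    have "\<exists>k. \<forall>\<sigma>\<in>W - G. \<not> (\<forall>i<k. \<sigma> i \<le> m i)"
    proof (rule box_tube)
      show "closed (W - G)" using W G(1) by (rule closed_Diff)
      fix \<sigma> assume \<sigma>: "\<sigma> \<in> W - G"
      then have "F \<sigma> \<notin> F ` K" using G(2) C(3) by blast
      then show "\<not> (\<forall>i. \<sigma> i \<le> m i)" using \<sigma> by (auto simp: K_def)
    qed
    then obtain k where "F ` S k \<subseteq> C n" unfolding S using G(2) by blast
    then have "outer_measure_of Q (F ` S k) \<le> outer_measure_of Q (C n)" by (rule outer_measure_of_mono)
    then show ?thesis using Sc[of k] C(1) Q(2) by simp
  qed
  moreover have "(INF n. emeasure Q (C n)) = emeasure Q (\<Inter>n. C n)"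
    using C(1,2) Q(2) finite_measure.emeasure_finite[OF Q(1)]
    by (intro INF_emeasure_decseq) (auto simp: decseq_Suc_iff)
  ultimately have "c \<le> emeasure Q (F ` K)"
    using C(3) by (metis INF_greatest)
  moreover have "F ` K \<in> sets Q" using cl Q(2) by simp
  moreover have "F ` K \<subseteq> F ` W" by (auto simp: K_def)
  ultimately show ?thesis by blast
qed

text \<open>The image lies between a countable union of measurable subsets and a measurable superset of
  the same measure.\<close>

lemma analytic_sets_completion:
  fixes F :: "(nat \<Rightarrow> nat) \<Rightarrow> 'q::topological_space"
  assumes met: "metrizable_space (euclidean :: 'q topology)"
    and W: "closed W" and F: "continuous_on W F"
    and Q: "finite_measure Q" "sets Q = sets borel"
  shows "F ` W \<in> sets (completion Q)"
proof -
  interpret finite_measure Q by fact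
  have spQ: "space Q = UNIV" using Q(2) sets_eq_imp_space_eq[of Q borel] by simp
  obtain E where E: "E \<in> sets Q" "F ` W \<subseteq> E" "outer_measure_of Q (F ` W) = emeasure Q E"
    using outer_measure_of_attain[of "F ` W" Q] spQ by auto
  define I where "I = {K\<in>sets Q. K \<subseteq> F ` W}"
  have "{} \<in> I" by (simp add: I_def)
  then have "I \<noteq> {}" by blast
  from ennreal_SUP_countable_SUP[OF this, of "emeasure Q"]
  obtain f :: "nat \<Rightarrow> ennreal" where f: "range f \<subseteq> emeasure Q ` I" "(SUP K\<in>I. emeasure Q K) = (SUP n. f n)"
    by blast
  have "\<exists>K\<in>I. f n = emeasure Q K" for n using f(1) by blast
  then obtain K where K: "\<And>n. K n \<in> I" "\<And>n. f n = emeasure Q (K n)" by metis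
  define K' where "K' = (\<Union>n. K n)"
  have K'I: "K' \<in> I" using K(1) unfolding K'_def I_def by blast
  have "(SUP n. f n) \<le> emeasure Q K'"
    using K K'I unfolding K'_def I_def by (intro SUP_least) (auto intro!: emeasure_mono)
  moreover have "emeasure Q E \<le> (SUP K\<in>I. emeasure Q K)"
  proof (rule ccontr)
    assume "\<not> ?thesis"
    then obtain c where c: "(SUP K\<in>I. emeasure Q K) < c" "c < outer_measure_of Q (F ` W)"
      using dense E(3) by (metis not_le)
    from analytic_inner_approximation[OF met W F Q c(2)]
    obtain L where "L \<in> I" "c \<le> emeasure Q L" unfolding I_def by blast
    then have "c \<le> (SUP K\<in>I. emeasure Q K)" by (meson SUP_upper order_trans)
    with c(1) show False by simp
  qed
  ultimately have "emeasure Q E \<le> emeasure Q K'" using f(2) by simp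
  then have "E - K' \<in> null_sets Q"
    using E K'I emeasure_Diff[of Q K' E]
    by (auto simp: I_def less_top[symmetric] intro!: null_setsI diff_eq_0_ennreal)
  moreover have "F ` W = K' \<union> (F ` W - K')" "F ` W - K' \<subseteq> E - K'" "K' \<in> sets Q"
    using E K'I by (auto simp: I_def)
  ultimately show ?thesis by (intro sets_completionI[of "F ` W" K' "F ` W - K'" "E - K'"])
qed

lemma closed_map_nth: "closed {\<sigma> :: nat \<Rightarrow> nat. map \<sigma> [0..<n] = l}"
  unfolding closed_nat_fun_iff
proof (intro allI impI CollectI)
  fix \<sigma> assume "\<forall>k. \<exists>\<tau>\<in>{\<sigma>. map \<sigma> [0..<n] = l}. agree k \<sigma> \<tau>"
  then obtain \<tau> where "map \<tau> [0..<n] = l" "agree n \<sigma> \<tau>" by blast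
  then show "map \<sigma> [0..<n] = l" by (auto simp: agree_def)
qed

text \<open>The section picks the lexicographically least point of each fibre, which exists because the
  fibre is closed.  Whether the next entry can be \<open>j\<close> is the question whether \<open>q\<close> lies in the
  image of the closed set of sequences with a given initial segment, so every entry depends
  measurably on \<open>q\<close>.\<close>

lemma continuous_section_completion:
  fixes F :: "(nat \<Rightarrow> nat) \<Rightarrow> 'q::topological_space"
  assumes met: "metrizable_space (euclidean :: 'q topology)"
    and W: "closed W" and F: "continuous_on W F"
    and Q: "finite_measure Q" "sets Q = sets borel"
  obtains s where "s \<in> borel_measurable (completion Q)"
    "\<And>q. q \<in> F ` W \<Longrightarrow> s q \<in> W \<and> F (s q) = q"
proof -
  have spQ: "space Q = UNIV" using Q(2) sets_eq_imp_space_eq[of Q borel] by simp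
  define Z where "Z l = F ` {\<sigma> \<in> W. map \<sigma> [0..<length l] = l}" for l
  have Z: "Z l \<in> sets (completion Q)" for l
  proof -
    have "{\<sigma> \<in> W. map \<sigma> [0..<length l] = l} = W \<inter> {\<sigma>. map \<sigma> [0..<length l] = l}" by auto
    then have "closed {\<sigma> \<in> W. map \<sigma> [0..<length l] = l}"
      using W closed_map_nth[of "length l" l] by (simp add: closed_Int)
    moreover have "continuous_on {\<sigma> \<in> W. map \<sigma> [0..<length l] = l} F"
      using F by (rule continuous_on_subset) auto
    ultimately show ?thesis unfolding Z_def by (rule analytic_sets_completion[OF met _ _ Q])
  qed
  define ext where "ext l q = (LEAST j. q \<in> Z (l @ [j]))" for l q
  define pre where "pre n q = rec_nat [] (\<lambda>_ l. l @ [ext l q]) n" for n q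
  have pre_0: "pre 0 q = []" and pre_Suc: "pre (Suc n) q = pre n q @ [ext (pre n q) q]" for n q
    by (simp_all add: pre_def)
  define s where "s q n = ext (pre n q) q" for q n
  have pre_s: "pre n q = map (s q) [0..<n]" for n q
    by (induction n) (simp_all add: pre_0 pre_Suc s_def)
  have ext_meas: "ext l \<in> completion Q \<rightarrow>\<^sub>M count_space UNIV" for l
  proof -
    have "{q \<in> space (completion Q). q \<in> Z (l @ [j])} \<in> sets (completion Q)" for j
      using Z[of "l @ [j]"] by (simp add: spQ)
    then show ?thesis unfolding ext_def by (intro measurable_Least) (simp add: pred_def)
  qed
  have pre_meas: "pre n \<in> completion Q \<rightarrow>\<^sub>M count_space UNIV" for n
  proof (induction n)
    case 0
    have "pre 0 = (\<lambda>_. [])" by (simp add: fun_eq_iff pre_0)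
    then show ?case by simp
  next
    case (Suc n)
    have "(\<lambda>q. l @ [ext l q]) \<in> completion Q \<rightarrow>\<^sub>M count_space UNIV" for l
      using measurable_compose[OF ext_meas[of l], of "\<lambda>j. l @ [j]" "count_space UNIV"] by simp
    from measurable_compose_countable[OF this Suc]
    show ?case by (simp add: pre_Suc[abs_def] fun_eq_iff)
  qed
  have "(\<lambda>q. s q n) \<in> completion Q \<rightarrow>\<^sub>M count_space UNIV" for n
    unfolding s_def by (rule measurable_compose_countable[OF ext_meas pre_meas])
  then have "(\<lambda>q. s q n) \<in> borel_measurable (completion Q)" for n
    using measurable_compose[of "\<lambda>q. s q n" "completion Q" "count_space UNIV" "\<lambda>x. x" borel] by simp
  then have "s \<in> borel_measurable (completion Q)"
    by (rule measurable_coordinatewise_then_product)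
  moreover have "s q \<in> W \<and> F (s q) = q" if q: "q \<in> F ` W" for q
  proof -
    have Zpre: "q \<in> Z (pre n q)" for n
    proof (induction n)
      case 0 show ?case using q by (simp add: Z_def pre_0)
    next
      case (Suc n)
      then obtain \<sigma> where \<sigma>: "\<sigma> \<in> W" "map \<sigma> [0..<length (pre n q)] = pre n q" "F \<sigma> = q"
        by (auto simp: Z_def)
      then have "q \<in> Z (pre n q @ [\<sigma> (length (pre n q))])"
        unfolding Z_def by (intro image_eqI[of _ _ \<sigma>]) auto
      then have "q \<in> Z (pre n q @ [ext (pre n q) q])" unfolding ext_def by (rule LeastI)
      then show ?case by (simp add: pre_Suc)
    qed
    have "closed {q}" using met by (metis closed_closedin closedin_t1_singleton metrizable_imp_t1_space iso_tuple_UNIV_I topspace_euclidean)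
    then have "closed (W \<inter> F -` {q})" by (rule continuous_closed_preimage[OF F W])
    moreover have "\<exists>\<tau>\<in>W \<inter> F -` {q}. agree n (s q) \<tau>" for n
    proof -
      obtain \<sigma> where \<sigma>: "\<sigma> \<in> W" "map \<sigma> [0..<n] = map (s q) [0..<n]" "F \<sigma> = q"
        using Zpre[of n] unfolding Z_def by (auto simp: pre_s)
      then have "agree n (s q) \<sigma>" by (simp add: agree_def)
      with \<sigma> show ?thesis by auto
    qed
    ultimately have "s q \<in> W \<inter> F -` {q}" unfolding closed_nat_fun_iff by blast
    then show ?thesis by simp
  qed
  ultimately show thesis by (rule that)
qed

section \<open>Measurable sections of Borel maps\<close>

lemma space_borel_of [simp]: "space (borel_of T) = topspace T"
  by (simp add: borel_of_def space_measure_of_conv)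

lemma borel_probsD:
  fixes Q :: "'q::topological_space measure"
  assumes "Q \<in> borel_probs euclidean"
  shows "prob_space Q" "sets Q = sets borel" "space Q = UNIV"
  using assms sets_eq_imp_space_eq[of Q borel] by (auto simp: borel_probs_def sets_borel_of_euclidean)

lemma separable_metrizable_imp_second_countable:
  assumes "metrizable_space X" "separable_space X"
  shows "second_countable X"
proof -
  obtain M d where "Metric_space M d" and X: "X = Metric_space.mtopology M d"
    using assms(1) metrizable_space_def by blast
  interpret Metric_space M d by fact
  obtain C where C: "countable C" "C \<subseteq> M" "mtopology closure_of C = M"
    using assms(2) unfolding separable_space_def X by auto
  define B where "B = (\<lambda>(c, n). mball c (1 / real (Suc n))) ` (C \<times> UNIV)"
  have "countable B" unfolding B_def using C(1) by (intro countable_image countable_SIGMA) auto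
  moreover have "openin X V" if "V \<in> B" for V
    using that by (auto simp: B_def X)
  moreover have "\<exists>V\<in>B. x \<in> V \<and> V \<subseteq> U" if U: "openin X U" "x \<in> U" for U x
  proof -
    obtain e where e: "e > 0" "mball x e \<subseteq> U" and x: "x \<in> M"
      using U openin_mtopology unfolding X by blast
    obtain n where n: "1 / real (Suc n) < e/2"
      using e(1) nat_approx_posE[of "e/2"] by auto
    have "x \<in> mtopology closure_of C" "0 < 1 / real (Suc n)" using C(3) x by auto
    then obtain c where c: "c \<in> C" "c \<in> mball x (1 / real (Suc n))"
      unfolding metric_closure_of by blast
    have "mball c (1 / real (Suc n)) \<subseteq> mball x e"
      using n c(2) x by (intro mball_subset) (auto simp: commute)
    then have "mball c (1 / real (Suc n)) \<subseteq> U" using e(2) by (rule subset_trans)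
    moreover have "x \<in> mball c (1 / real (Suc n))" using c(2) by (auto simp: commute)
    moreover have "mball c (1 / real (Suc n)) \<in> B"
      unfolding B_def using c(1) by (intro image_eqI[of _ _ "(c, n)"]) auto
    ultimately show ?thesis by (intro bexI[of _ "mball c (1 / real (Suc n))"] conjI)
  qed
  ultimately show ?thesis
    unfolding second_countable_def by (intro exI[of _ B]) blast
qed

text \<open>By second countability the complement of the support is a countable union of null base
  sets.\<close>

lemma AE_supp:
  fixes Q :: "'q::topological_space measure"
  assumes "second_countable (euclidean :: 'q topology)" and Q: "Q \<in> borel_probs euclidean"
  shows "AE q in Q. q \<in> supp Q"
proof -
  interpret prob_space Q using borel_probsD(1)[OF Q] .
  obtain B where B: "countable B" "\<And>V. V \<in> B \<Longrightarrow> open V"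
    "\<And>U x. open U \<Longrightarrow> x \<in> U \<Longrightarrow> \<exists>V\<in>B. x \<in> V \<and> V \<subseteq> (U :: 'q set)"
    using assms(1) unfolding second_countable_def by auto
  have "(\<Union>V\<in>{V \<in> B. measure Q V = 0}. V) \<in> null_sets Q"
    using B borel_probsD(2)[OF Q]
    by (intro null_sets_UN') (auto simp: null_sets_def emeasure_eq_measure)
  moreover have "{q \<in> space Q. q \<notin> supp Q} \<subseteq> (\<Union>V\<in>{V \<in> B. measure Q V = 0}. V)"
  proof
    fix q assume "q \<in> {q \<in> space Q. q \<notin> supp Q}"
    then obtain U where U: "open U" "q \<in> U" "\<not> 0 < measure Q U" by (auto simp: supp_def)
    then obtain V where V: "V \<in> B" "q \<in> V" "V \<subseteq> U" using B(3) by blast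
    have "measure Q V \<le> measure Q U"
      using V(3) U(1) borel_probsD(2)[OF Q] by (intro finite_measure_mono) auto
    then have "measure Q V = 0" using U(3) measure_nonneg[of Q V] by linarith
    with V show "q \<in> (\<Union>V\<in>{V \<in> B. measure Q V = 0}. V)" by blast
  qed
  ultimately show ?thesis by (rule AE_I')
qed

text \<open>The Jankov--von Neumann selection theorem for one measure: a parametrization that decides
  \<open>C\<close> and the preimages of a countable base turns \<open>\<Psi>\<close> into a continuous map on a closed set of
  sequences, where the lexicographic section applies.  The default value \<open>a0\<close> only serves to make
  the section total, so that several sections can be glued without restricting measures.\<close>

lemma borel_section_completion:
  fixes T :: "'a topology" and \<Psi> :: "'a \<Rightarrow> 'q::topological_space"
  assumes T: "suslin_space T" and a0: "a0 \<in> topspace T"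
    and met: "metrizable_space (euclidean :: 'q topology)"
    and sep: "separable_space (euclidean :: 'q topology)"
    and \<Psi>: "\<Psi> \<in> borel_of T \<rightarrow>\<^sub>M borel" and C: "C \<in> sets (borel_of T)"
    and Q: "finite_measure Q" "sets Q = sets borel"
  obtains \<psi> where "\<Psi> ` C \<in> sets (completion Q)" "\<psi> \<in> completion Q \<rightarrow>\<^sub>M borel_of T"
    "\<And>q. q \<in> \<Psi> ` C \<Longrightarrow> \<psi> q \<in> C \<and> \<Psi> (\<psi> q) = q"
proof -
  have spQ: "space Q = UNIV" using Q(2) sets_eq_imp_space_eq[of Q borel] by simp
  have CT: "C \<subseteq> topspace T" using sets.sets_into_space[OF C] by simp
  obtain \<B> where \<B>: "countable \<B>" "\<And>V. V \<in> \<B> \<Longrightarrow> open V"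
    "\<And>U x. open U \<Longrightarrow> x \<in> U \<Longrightarrow> \<exists>V\<in>\<B>. x \<in> V \<and> V \<subseteq> (U :: 'q set)"
    using separable_metrizable_imp_second_countable[OF met sep] unfolding second_countable_def by auto
  have "\<B> \<noteq> {}" using \<B>(3)[OF open_UNIV] by blast
  define V where "V = from_nat_into \<B>"
  have V: "open (V n)" for n unfolding V_def using \<B>(2) \<open>\<B> \<noteq> {}\<close> by (simp add: from_nat_into)
  have V_base: "\<exists>n. x \<in> V n \<and> V n \<subseteq> U" if "open U" "x \<in> U" for U x
    using \<B>(3)[OF that] from_nat_into_surj[OF \<B>(1)] unfolding V_def by metis
  define X where "X = case_nat C (\<lambda>n. \<Psi> -` V n \<inter> topspace T)"
  have X: "X n \<in> sets (borel_of T)" for n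
  proof (cases n)
    case 0 then show ?thesis using C by (simp add: X_def)
  next
    case (Suc k)
    have "\<Psi> -` V k \<inter> space (borel_of T) \<in> sets (borel_of T)"
      by (rule measurable_sets[OF \<Psi> borel_open[OF V]])
    with Suc show ?thesis by (simp add: X_def)
  qed
  obtain W \<phi> where W: "parametrizes T W \<phi>" and dec: "\<And>n. locally_decides W \<phi> (X n)"
    by (rule borel_sequence_parametrization[of T X, OF T X]) blast
  have clW: "closed W" and \<phi>: "continuous_map (top_of_set W) T \<phi>" and im: "\<phi> ` W = topspace T"
    using W by (auto simp: parametrizes_def)
  define W1 where "W1 = {\<sigma> \<in> W. \<phi> \<sigma> \<in> C}"
  define F where "F = \<Psi> \<circ> \<phi>"
  have "closed W1"
    unfolding closed_nat_fun_iff
  proof (intro allI impI)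
    fix \<sigma> assume *: "\<forall>n. \<exists>\<tau>\<in>W1. agree n \<sigma> \<tau>"
    then have "\<sigma> \<in> W" using clW unfolding closed_nat_fun_iff W1_def by blast
    with dec[of 0] obtain n where "\<forall>\<tau>\<in>W. agree n \<sigma> \<tau> \<longrightarrow> (\<phi> \<tau> \<in> C) = (\<phi> \<sigma> \<in> C)"
      unfolding locally_decides_def X_def by auto
    with * \<open>\<sigma> \<in> W\<close> show "\<sigma> \<in> W1" unfolding W1_def by blast
  qed
  have "continuous_on W1 F"
    unfolding continuous_openin_preimage_eq
  proof (intro allI impI)
    fix U :: "'q set" assume "open U"
    show "openin (top_of_set W1) (W1 \<inter> F -` U)"
      unfolding openin_nat_fun_iff
    proof (intro conjI ballI)
      fix \<sigma> assume \<sigma>: "\<sigma> \<in> W1 \<inter> F -` U"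
      then obtain n where n: "F \<sigma> \<in> V n" "V n \<subseteq> U" using V_base[OF \<open>open U\<close>, of "F \<sigma>"] by auto
      have X: "(\<phi> \<tau> \<in> X (Suc n)) = (F \<tau> \<in> V n)" if "\<tau> \<in> W" for \<tau>
        using that im by (auto simp: X_def F_def)
      obtain k where "\<forall>\<tau>\<in>W. agree k \<sigma> \<tau> \<longrightarrow> (\<phi> \<tau> \<in> X (Suc n)) = (\<phi> \<sigma> \<in> X (Suc n))"
        using dec[of "Suc n"] \<sigma> unfolding locally_decides_def W1_def by blast
      with X \<sigma> n have "\<forall>\<tau>\<in>W1. agree k \<sigma> \<tau> \<longrightarrow> \<tau> \<in> W1 \<inter> F -` U"
        unfolding W1_def by blast
      then show "\<exists>k. \<forall>\<tau>\<in>W1. agree k \<sigma> \<tau> \<longrightarrow> \<tau> \<in> W1 \<inter> F -` U" by blast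
    qed auto
  qed
  note FW1 = \<open>closed W1\<close> \<open>continuous_on W1 F\<close>
  have FC: "F ` W1 = \<Psi> ` C"
  proof
    show "\<Psi> ` C \<subseteq> F ` W1"
    proof
      fix q assume "q \<in> \<Psi> ` C"
      then obtain a where a: "a \<in> C" "q = \<Psi> a" by blast
      with CT im obtain \<sigma> where "\<sigma> \<in> W" "a = \<phi> \<sigma>" by blast
      with a show "q \<in> F ` W1" by (auto simp: W1_def F_def)
    qed
  qed (auto simp: W1_def F_def)
  have meas: "\<Psi> ` C \<in> sets (completion Q)"
    using analytic_sets_completion[OF met FW1 Q] by (simp add: FC)
  obtain s where s: "s \<in> borel_measurable (completion Q)"
      and sec: "\<And>q. q \<in> F ` W1 \<Longrightarrow> s q \<in> W1 \<and> F (s q) = q"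
    by (rule continuous_section_completion[OF met FW1 Q]) blast
  note sec = sec[unfolded FC]
  have \<phi>_meas: "\<phi> \<in> restrict_space borel W1 \<rightarrow>\<^sub>M borel_of T"
    unfolding borel_of_def
  proof (rule measurable_measure_of)
    show "\<phi> \<in> space (restrict_space borel W1) \<rightarrow> topspace T"
      using im by (auto simp: W1_def space_restrict_space)
    fix U assume "U \<in> {U. openin T U}"
    then have "openin (top_of_set W) {\<sigma> \<in> topspace (top_of_set W). \<phi> \<sigma> \<in> U}"
      using \<phi> by (intro openin_continuous_map_preimage) auto
    then obtain G where "open G" "{\<sigma> \<in> W. \<phi> \<sigma> \<in> U} = W \<inter> G" by (auto simp: openin_open)
    then have "\<phi> -` U \<inter> space (restrict_space borel W1) = G \<inter> W1" "G \<in> sets borel"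
      by (auto simp: space_restrict_space W1_def)
    then show "\<phi> -` U \<inter> space (restrict_space borel W1) \<in> sets (restrict_space borel W1)"
      using FW1(1) by (auto simp: sets_restrict_space_iff)
  qed (auto dest: openin_subset)
  have "s \<in> restrict_space (completion Q) (\<Psi> ` C) \<rightarrow>\<^sub>M restrict_space borel W1"
    using s sec by (intro measurable_restrict_space2 measurable_restrict_space1) (auto simp: space_restrict_space)
  then have "(\<lambda>q. \<phi> (s q)) \<in> restrict_space (completion Q) (\<Psi> ` C) \<rightarrow>\<^sub>M borel_of T"
    using \<phi>_meas by (rule measurable_compose)
  then have "(\<lambda>q. if q \<in> \<Psi> ` C then \<phi> (s q) else a0) \<in> completion Q \<rightarrow>\<^sub>M borel_of T"
    using meas a0 by (subst measurable_If_restrict_space_iff) (auto simp: spQ)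
  moreover have "\<phi> (s q) \<in> C \<and> \<Psi> (\<phi> (s q)) = q" if "q \<in> \<Psi> ` C" for q
    using sec[OF that] by (auto simp: W1_def F_def)
  ultimately show thesis using meas by (intro that) auto
qed

lemma distr_section:
  fixes \<Psi> :: "'a \<Rightarrow> 'q::topological_space"
  assumes \<psi>: "\<psi> \<in> completion Q \<rightarrow>\<^sub>M borel_of T" and \<Psi>: "\<Psi> \<in> borel_of T \<rightarrow>\<^sub>M borel"
    and Q: "sets Q = sets borel" and AE: "AE q in completion Q. \<Psi> (\<psi> q) = q"
  shows "distr (distr (completion Q) (borel_of T) \<psi>) borel \<Psi> = Q"
proof -
  have id: "(\<lambda>q. q) \<in> Q \<rightarrow>\<^sub>M borel" using measurable_ident_sets[OF Q] by simp
  have "distr (distr (completion Q) (borel_of T) \<psi>) borel \<Psi> = distr (completion Q) borel (\<Psi> \<circ> \<psi>)"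
    by (rule distr_distr[OF \<Psi> \<psi>])
  also have "\<dots> = distr (completion Q) borel (\<lambda>q. q)"
    using AE measurable_comp[OF \<psi> \<Psi>] measurable_completion[OF id] by (intro distr_cong_AE) auto
  also have "\<dots> = distr Q borel (\<lambda>q. q)" by (rule distr_completion[OF id])
  also have "\<dots> = Q" using Q by (intro distr_id2) simp
  finally show ?thesis .
qed

section \<open>A prior with a nearly maximal conditional expectation\<close>

text \<open>The shortfall \<open>(u - Y) X\<close> is at most \<open>\<delta>' X\<close> on \<open>E\<^sub>1\<close>, at most \<open>(u - l) t\<close> on the rest of
  \<open>E\<^sub>2\<close>, and at most \<open>u - l\<close> elsewhere.  Integrating, and dividing by the total weight, which is at
  least \<open>c\<close>, gives the bound.\<close>

lemma (in prob_space) weighted_mean_lower_bound: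
  fixes X Y :: "'a \<Rightarrow> real"
  assumes [measurable]: "X \<in> borel_measurable M" "Y \<in> borel_measurable M" "E\<^sub>1 \<in> events" "E\<^sub>2 \<in> events"
    and X: "\<And>x. x \<in> space M \<Longrightarrow> 0 \<le> X x \<and> X x \<le> 1"
    and Y: "\<And>x. x \<in> space M \<Longrightarrow> l \<le> Y x \<and> Y x \<le> u"
    and E1: "\<And>x. x \<in> E\<^sub>1 \<Longrightarrow> u - \<delta>' \<le> Y x"
    and E2: "\<And>x. x \<in> E\<^sub>2 - E\<^sub>1 \<Longrightarrow> X x \<le> t"
    and "0 \<le> \<delta>'" "0 \<le> t" and c: "0 < c" "c \<le> (\<integral>x. indicator E\<^sub>1 x * X x \<partial>M)"
  shows "0 < (\<integral>x. X x \<partial>M)"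
    and "u - \<delta>' - (u - l) * (t + (1 - prob E\<^sub>2)) / c \<le> (\<integral>x. Y x * X x \<partial>M) / (\<integral>x. X x \<partial>M)"
proof -
  define b where "b = max \<bar>l\<bar> \<bar>u\<bar>"
  have iX: "integrable M X"
    by (rule integrable_const_bound[of _ 1]) (use X in auto)
  have iE: "integrable M (\<lambda>x. indicator E\<^sub>1 x * X x)"
    by (rule integrable_const_bound[of _ 1]) (use X in \<open>auto simp: indicator_def\<close>)
  have iYX: "integrable M (\<lambda>x. Y x * X x)"
  proof (rule integrable_const_bound[of _ b])
    have "\<bar>Y x * X x\<bar> \<le> b * 1" if "x \<in> space M" for x
      unfolding abs_mult using X[OF that] Y[OF that] by (intro mult_mono) (auto simp: b_def)
    then show "AE x in M. norm (Y x * X x) \<le> b" by (intro AE_I2) simp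
  qed simp
  have iI: "integrable M (\<lambda>x. indicator (space M - E\<^sub>2) x :: real)"
    by (rule integrable_const_bound[of _ 1]) (auto simp: indicator_def)
  have cX: "c \<le> (\<integral>x. X x \<partial>M)"
    using c(2) integral_mono[OF iE iX] X by (fastforce simp: indicator_def)
  with c(1) show pos: "0 < (\<integral>x. X x \<partial>M)" by simp
  have lu: "0 \<le> u - l"
    using Y not_empty by (metis all_not_in_conv diff_ge_0_iff_ge order_trans)
  have "(\<integral>x. u * X x - Y x * X x \<partial>M) \<le> (\<integral>x. \<delta>' * X x + (u - l) * (t + indicator (space M - E\<^sub>2) x) \<partial>M)"
  proof (rule integral_mono)
    fix x assume x: "x \<in> space M"
    have E1_bound: "(u - Y x) * X x \<le> \<delta>' * X x" if "x \<in> E\<^sub>1"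
      using E1[OF that] X[OF x] by (intro mult_right_mono) auto
    have E2_bound: "(u - Y x) * X x \<le> (u - l) * t" if "x \<in> E\<^sub>2 - E\<^sub>1"
      using E2[OF that] X[OF x] Y[OF x] by (intro mult_mono) auto
    have trivial_bound: "(u - Y x) * X x \<le> (u - l) * 1"
      using X[OF x] Y[OF x] by (intro mult_mono) auto
    have nonneg: "0 \<le> (u - l) * t" "0 \<le> \<delta>' * X x" "0 \<le> (u - l) * indicator (space M - E\<^sub>2) x"
      using lu \<open>0 \<le> t\<close> \<open>0 \<le> \<delta>'\<close> X[OF x] by (auto intro!: mult_nonneg_nonneg)
    consider "x \<in> E\<^sub>1" | "x \<in> E\<^sub>2 - E\<^sub>1" | "x \<notin> E\<^sub>2" by blast
    then have "(u - Y x) * X x \<le> \<delta>' * X x + ((u - l) * t + (u - l) * indicator (space M - E\<^sub>2) x)"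
    proof cases
      case 1
      show ?thesis using E1_bound[OF 1] nonneg by linarith
    next
      case 2
      show ?thesis using E2_bound[OF 2] nonneg by linarith
    next
      case 3
      then have "(u - l) * indicator (space M - E\<^sub>2) x = (u - l) * 1" using x by simp
      then show ?thesis using trivial_bound nonneg by linarith
    qed
    then show "u * X x - Y x * X x \<le> \<delta>' * X x + (u - l) * (t + indicator (space M - E\<^sub>2) x)"
      by (simp only: left_diff_distrib distrib_left)
  next
    show "integrable M (\<lambda>x. u * X x - Y x * X x)" using iX iYX by simp
    show "integrable M (\<lambda>x. \<delta>' * X x + (u - l) * (t + indicator (space M - E\<^sub>2) x))"
      by (intro Bochner_Integration.integrable_add integrable_mult_right iX iI integrable_const)
  qed
  moreover have "(\<integral>x. u * X x - Y x * X x \<partial>M) = u * (\<integral>x. X x \<partial>M) - (\<integral>x. Y x * X x \<partial>M)"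
    using iX iYX by simp
  moreover have "(\<integral>x. \<delta>' * X x + (u - l) * (t + indicator (space M - E\<^sub>2) x) \<partial>M)
      = \<delta>' * (\<integral>x. X x \<partial>M) + (u - l) * (t + (1 - prob E\<^sub>2))"
    using iX iI by (simp add: prob_compl prob_space)
  ultimately have "(u - \<delta>') * (\<integral>x. X x \<partial>M) - (u - l) * (t + (1 - prob E\<^sub>2)) \<le> (\<integral>x. Y x * X x \<partial>M)"
    by (simp add: algebra_simps)
  then have "((u - \<delta>') * (\<integral>x. X x \<partial>M) - (u - l) * (t + (1 - prob E\<^sub>2))) / (\<integral>x. X x \<partial>M)
      \<le> (\<integral>x. Y x * X x \<partial>M) / (\<integral>x. X x \<partial>M)"
    using pos by (intro divide_right_mono) auto
  then have "u - \<delta>' - (u - l) * (t + (1 - prob E\<^sub>2)) / (\<integral>x. X x \<partial>M) \<le> (\<integral>x. Y x * X x \<partial>M) / (\<integral>x. X x \<partial>M)"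
    using pos by (simp add: diff_divide_distrib)
  moreover have "(u - l) * (t + (1 - prob E\<^sub>2)) / (\<integral>x. X x \<partial>M) \<le> (u - l) * (t + (1 - prob E\<^sub>2)) / c"
    using cX c(1) lu \<open>0 \<le> t\<close> prob_le_1[of E\<^sub>2] by (intro divide_left_mono) auto
  ultimately show "u - \<delta>' - (u - l) * (t + (1 - prob E\<^sub>2)) / c \<le> (\<integral>x. Y x * X x \<partial>M) / (\<integral>x. X x \<partial>M)"
    by linarith
qed


text \<open>Here \<open>p\<close> is the probability of the observed event and \<open>\<kappa>\<close> bounds the \<open>Q\<close>-measure of the \<open>q\<close>
  whose fibre has no scenario with small \<open>p\<close>.  The slack \<open>e\<close> pays for the infimum of
  \<open>p\<close> over a fibre not being attained.  It is important that the section over the good set, and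
  with it the weight \<open>c\<close>, is fixed before \<open>\<eta>\<close>: when \<open>\<epsilon> = 0\<close> nothing but positivity is known
  about \<open>c\<close>, and \<open>\<eta>\<close> has to be small in comparison with it.\<close>

lemma near_optimal_prior:
  fixes T :: "'a topology" and \<Psi> :: "'a \<Rightarrow> 'q::topological_space" and \<Phi> p :: "'a \<Rightarrow> real"
  assumes T: "suslin_space T"
    and met: "metrizable_space (euclidean :: 'q topology)"
    and sep: "separable_space (euclidean :: 'q topology)"
    and \<Psi>: "\<Psi> \<in> borel_of T \<rightarrow>\<^sub>M borel"
    and \<Phi>[measurable]: "\<Phi> \<in> borel_measurable (borel_of T)"
    and p[measurable]: "p \<in> borel_measurable (borel_of T)"
    and Q: "Q \<in> borel_probs euclidean" and supp: "supp Q \<subseteq> \<Psi> ` topspace T"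
    and \<Phi>_bounds: "\<And>a. a \<in> topspace T \<Longrightarrow> l \<le> \<Phi> a \<and> \<Phi> a \<le> u"
    and p_bounds: "\<And>a. a \<in> topspace T \<Longrightarrow> 0 \<le> p a \<and> p a \<le> 1"
    and good: "\<epsilon>' \<le> measure (completion Q) (\<Psi> ` {a \<in> topspace T. \<epsilon> < p a \<and> u - \<delta>' < \<Phi> a})"
    and small: "\<And>\<eta>. 0 < \<eta> \<Longrightarrow> 1 - \<kappa> \<le> measure (completion Q) (\<Psi> ` {a \<in> topspace T. p a < \<tau> + \<eta>})"
    and key: "(u - l) * (\<kappa> + \<tau>) \<le> \<epsilon> * \<delta>' * \<epsilon>'"
    and "0 \<le> \<tau>" "0 \<le> \<epsilon>" "0 < \<epsilon>'" "0 < \<delta>'" "0 < e"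
  shows "\<exists>\<pi>\<in>borel_probs T. distr \<pi> borel \<Psi> = Q \<and> 0 < (\<integral>a. p a \<partial>\<pi>) \<and>
           u - 2 * \<delta>' - e \<le> (\<integral>a. \<Phi> a * p a \<partial>\<pi>) / (\<integral>a. p a \<partial>\<pi>)"
proof -
  interpret Q: prob_space Q using borel_probsD(1)[OF Q] .
  note spQ = borel_probsD(3)[OF Q] and setsQ = borel_probsD(2)[OF Q]
  define M where "M = completion Q"
  interpret prob_space M unfolding M_def by (rule prob_spaceI) (simp add: Q.emeasure_space_1)
  have spM: "space M = UNIV" by (simp add: M_def spQ)
  have Qfin: "finite_measure Q" by unfold_locales
  define C1 where "C1 = {a \<in> topspace T. \<epsilon> < p a \<and> u - \<delta>' < \<Phi> a}"
  have "\<Psi> ` C1 \<noteq> {}"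
  proof
    assume "\<Psi> ` C1 = {}"
    with good have "\<epsilon>' \<le> 0" unfolding C1_def[symmetric] by (simp only: measure_empty)
    with \<open>0 < \<epsilon>'\<close> show False by simp
  qed
  then obtain a0 where a0: "a0 \<in> topspace T" by (auto simp: C1_def)
  then have lu: "l \<le> u" using \<Phi>_bounds by force
  note sections = borel_section_completion[OF T a0 met sep \<Psi> _ Qfin setsQ, folded M_def]
  have C1: "C1 \<in> sets (borel_of T)"
  proof -
    have "{a \<in> space (borel_of T). \<epsilon> < p a \<and> u - \<delta>' < \<Phi> a} \<in> sets (borel_of T)" by measurable
    then show ?thesis by (simp add: C1_def)
  qed
  obtain \<psi>1 where E1[measurable]: "\<Psi> ` C1 \<in> events" and \<psi>1[measurable]: "\<psi>1 \<in> M \<rightarrow>\<^sub>M borel_of T"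
    and s1: "\<And>q. q \<in> \<Psi> ` C1 \<Longrightarrow> \<psi>1 q \<in> C1 \<and> \<Psi> (\<psi>1 q) = q"
    by (rule sections[OF C1]) blast
  define c where "c = (\<integral>q. indicator (\<Psi> ` C1) q * p (\<psi>1 q) \<partial>M)"
  have \<psi>1_top: "\<psi>1 q \<in> topspace T" for q using measurable_space[OF \<psi>1, of q] by (simp add: spM)
  have ic: "integrable M (\<lambda>q. indicator (\<Psi> ` C1) q * p (\<psi>1 q))"
    by (rule integrable_const_bound[of _ 1]) (use p_bounds \<psi>1_top in \<open>auto simp: indicator_def\<close>)
  have P1: "\<epsilon>' \<le> prob (\<Psi> ` C1)" using good by (simp add: C1_def M_def)
  have "\<epsilon> * prob (\<Psi> ` C1) \<le> c"
  proof -
    have "(\<integral>q. \<epsilon> * indicator (\<Psi> ` C1) q \<partial>M) \<le> c"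
      unfolding c_def
    proof (rule integral_mono[OF _ ic])
      show "\<epsilon> * indicator (\<Psi> ` C1) q \<le> indicator (\<Psi> ` C1) q * p (\<psi>1 q)" for q
        using s1[of q] by (auto simp: indicator_def C1_def)
    qed (auto simp: less_top[symmetric])
    then show ?thesis by simp
  qed
  moreover have "\<epsilon> * \<epsilon>' \<le> \<epsilon> * prob (\<Psi> ` C1)" using P1 \<open>0 \<le> \<epsilon>\<close> by (rule mult_left_mono)
  ultimately have c_lower: "\<epsilon> * \<epsilon>' \<le> c" by simp
  have "c \<noteq> 0"
  proof
    assume "c = 0"
    then have "AE q in M. indicator (\<Psi> ` C1) q * p (\<psi>1 q) = 0"
      unfolding c_def using p_bounds \<psi>1_top
      by (subst (asm) integral_nonneg_eq_0_iff_AE[OF ic]) auto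
    then have "AE q in M. q \<notin> \<Psi> ` C1"
    proof eventually_elim
      case (elim q)
      then show ?case using s1[of q] \<open>0 \<le> \<epsilon>\<close> by (auto simp: C1_def)
    qed
    then have "prob (\<Psi> ` C1) = 0" using E1 by (subst prob_eq_0) auto
    with P1 \<open>0 < \<epsilon>'\<close> show False by simp
  qed
  moreover have "0 \<le> c" unfolding c_def using p_bounds \<psi>1_top by (intro Bochner_Integration.integral_nonneg) auto
  ultimately have c_pos: "0 < c" by simp
  \<comment> \<open>The summand \<open>1\<close> keeps the denominator positive when \<open>\<Phi>\<close> is constant.\<close>
  define \<eta> where "\<eta> = e * c / (u - l + 1)"
  have \<eta>: "0 < \<eta>" "(u - l) * \<eta> \<le> e * c"
    using lu c_pos \<open>0 < e\<close> by (auto simp: \<eta>_def field_simps)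
  define C2 where "C2 = {a \<in> topspace T. p a < \<tau> + \<eta>}"
  have C2: "C2 \<in> sets (borel_of T)"
  proof -
    have "{a \<in> space (borel_of T). p a < \<tau> + \<eta>} \<in> sets (borel_of T)" by measurable
    then show ?thesis by (simp add: C2_def)
  qed
  obtain \<psi>2 where E2[measurable]: "\<Psi> ` C2 \<in> events" and \<psi>2[measurable]: "\<psi>2 \<in> M \<rightarrow>\<^sub>M borel_of T"
    and s2: "\<And>q. q \<in> \<Psi> ` C2 \<Longrightarrow> \<psi>2 q \<in> C2 \<and> \<Psi> (\<psi>2 q) = q"
    by (rule sections[OF C2]) blast
  have top_sets: "topspace T \<in> sets (borel_of T)" using sets.top[of "borel_of T"] by simp
  obtain \<psi>3 where \<psi>3[measurable]: "\<psi>3 \<in> M \<rightarrow>\<^sub>M borel_of T"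
    and s3: "\<And>q. q \<in> \<Psi> ` topspace T \<Longrightarrow> \<psi>3 q \<in> topspace T \<and> \<Psi> (\<psi>3 q) = q"
    by (rule sections[OF top_sets]) blast
  define \<psi> where "\<psi> q = (if q \<in> \<Psi> ` C1 then \<psi>1 q else if q \<in> \<Psi> ` C2 then \<psi>2 q else \<psi>3 q)" for q
  have \<psi>[measurable]: "\<psi> \<in> M \<rightarrow>\<^sub>M borel_of T" unfolding \<psi>_def by measurable
  have \<psi>_top: "\<psi> q \<in> topspace T" for q using measurable_space[OF \<psi>, of q] by (simp add: spM)
  have "\<Psi> (\<psi> q) = q" if "q \<in> supp Q" for q
    using that supp s1[of q] s2[of q] s3[of q] by (auto simp: \<psi>_def)
  moreover have "AE q in M. q \<in> supp Q"
    unfolding M_def using AE_supp[OF separable_metrizable_imp_second_countable[OF met sep] Q]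
    by (rule AE_completion)
  ultimately have AE: "AE q in M. \<Psi> (\<psi> q) = q" by auto
  define \<pi> where "\<pi> = distr M (borel_of T) \<psi>"
  have \<pi>_prob: "\<pi> \<in> borel_probs T"
    unfolding \<pi>_def borel_probs_def using prob_space_distr[OF \<psi>] by simp
  have \<pi>_distr: "distr \<pi> borel \<Psi> = Q"
    unfolding \<pi>_def using \<psi> AE unfolding M_def by (intro distr_section[OF _ \<Psi> setsQ])
  have int_p: "(\<integral>a. p a \<partial>\<pi>) = (\<integral>q. p (\<psi> q) \<partial>M)"
    unfolding \<pi>_def by (rule integral_distr) auto
  have int_\<Phi>p: "(\<integral>a. \<Phi> a * p a \<partial>\<pi>) = (\<integral>q. \<Phi> (\<psi> q) * p (\<psi> q) \<partial>M)"
    unfolding \<pi>_def by (rule integral_distr) auto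
  have pos: "0 < (\<integral>q. p (\<psi> q) \<partial>M)"
    and mean: "u - \<delta>' - (u - l) * ((\<tau> + \<eta>) + (1 - prob (\<Psi> ` C2))) / c
           \<le> (\<integral>q. \<Phi> (\<psi> q) * p (\<psi> q) \<partial>M) / (\<integral>q. p (\<psi> q) \<partial>M)"
  proof -
    have c_eq: "c \<le> (\<integral>q. indicator (\<Psi> ` C1) q * p (\<psi> q) \<partial>M)"
      unfolding c_def by (intro eq_refl Bochner_Integration.integral_cong) (auto simp: \<psi>_def indicator_def)
    have 1: "u - \<delta>' \<le> \<Phi> (\<psi> q)" if "q \<in> \<Psi> ` C1" for q
      using s1[OF that] that by (auto simp: \<psi>_def C1_def)
    have 2: "p (\<psi> q) \<le> \<tau> + \<eta>" if "q \<in> \<Psi> ` C2 - \<Psi> ` C1" for q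
      using s2[of q] that by (auto simp: \<psi>_def C2_def)
    note bound = weighted_mean_lower_bound[of "\<lambda>q. p (\<psi> q)" "\<lambda>q. \<Phi> (\<psi> q)", OF _ _ E1 E2 _ _ 1 2 _ _ c_pos c_eq]
    show "0 < (\<integral>q. p (\<psi> q) \<partial>M)"
      by (rule bound(1)) (use p_bounds \<Phi>_bounds \<psi>_top \<open>0 < \<delta>'\<close> \<open>0 \<le> \<tau>\<close> \<eta>(1) in auto)
    show "u - \<delta>' - (u - l) * ((\<tau> + \<eta>) + (1 - prob (\<Psi> ` C2))) / c
           \<le> (\<integral>q. \<Phi> (\<psi> q) * p (\<psi> q) \<partial>M) / (\<integral>q. p (\<psi> q) \<partial>M)"
      by (rule bound(2)) (use p_bounds \<Phi>_bounds \<psi>_top \<open>0 < \<delta>'\<close> \<open>0 \<le> \<tau>\<close> \<eta>(1) in auto)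
  qed
  have "(u - l) * ((\<tau> + \<eta>) + (1 - prob (\<Psi> ` C2))) / c \<le> \<delta>' + e"
  proof -
    have "(u - l) * ((\<tau> + \<eta>) + (1 - prob (\<Psi> ` C2))) \<le> (u - l) * ((\<kappa> + \<tau>) + \<eta>)"
      using small[OF \<eta>(1)] lu by (intro mult_left_mono) (auto simp: C2_def M_def)
    also have "\<dots> = (u - l) * (\<kappa> + \<tau>) + (u - l) * \<eta>" by (rule distrib_left)
    also have "\<dots> \<le> \<delta>' * (\<epsilon> * \<epsilon>') + e * c" using key \<eta>(2) by (simp add: ac_simps)
    also have "\<dots> \<le> \<delta>' * c + e * c" using c_lower \<open>0 < \<delta>'\<close> by simp
    finally show ?thesis using c_pos by (simp add: field_simps)
  qed
  then have "u - 2 * \<delta>' - e \<le> (\<integral>a. \<Phi> a * p a \<partial>\<pi>) / (\<integral>a. p a \<partial>\<pi>)"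
    unfolding int_p int_\<Phi>p using mean by linarith
  moreover have "0 < (\<integral>a. p a \<partial>\<pi>)" using pos by (simp add: int_p)
  ultimately show ?thesis using \<pi>_prob \<pi>_distr by blast
qed

lemma upper_post_le:
  fixes T :: "'a topology" and DM :: "('a \<Rightarrow> 'd::topological_space measure) set"
  assumes \<Phi>: "\<Phi> \<in> borel_measurable (borel_of T)"
    and bounds: "\<And>a. a \<in> topspace T \<Longrightarrow> l \<le> \<Phi> a \<and> \<Phi> a \<le> u"
    and DM: "\<forall>D\<in>DM. data_map T D" and B: "B \<in> sets borel" and PR: "PR \<subseteq> borel_probs T"
  shows "upper_post \<Phi> PR DM B \<le> ereal u"
  unfolding upper_post_def
proof (rule Sup_least, safe)
  fix \<pi> D assume \<pi>: "\<pi> \<in> PR" and D: "D \<in> DM" and pos: "0 < data_prob \<pi> D B"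
  have \<pi>: "prob_space \<pi>" "sets \<pi> = sets (borel_of T)" using \<pi> PR by (auto simp: borel_probs_def)
  interpret prob_space \<pi> by fact
  have sp: "space \<pi> = topspace T" using sets_eq_imp_space_eq[OF \<pi>(2)] by simp
  have m: "borel_measurable \<pi> = borel_measurable (borel_of T)" by (rule measurable_cong_sets[OF \<pi>(2) refl])
  define p where "p = (\<lambda>a. measure (D a) B)"
  have p_meas[measurable]: "p \<in> borel_measurable \<pi>" and \<Phi>_meas[measurable]: "\<Phi> \<in> borel_measurable \<pi>"
    using DM D B \<Phi> by (auto simp: m p_def data_map_def)
  have p: "0 \<le> p a \<and> p a \<le> 1" if "a \<in> space \<pi>" for a
    using that DM D unfolding sp p_def data_map_def borel_probs_def by (auto intro: prob_space.prob_le_1)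
  have ip: "integrable \<pi> p"
    by (rule integrable_const_bound[of _ 1]) (use p in auto)
  define b where "b = max \<bar>l\<bar> \<bar>u\<bar>"
  have i\<Phi>p: "integrable \<pi> (\<lambda>a. \<Phi> a * p a)"
  proof (rule integrable_const_bound[of _ b])
    have "\<bar>\<Phi> a * p a\<bar> \<le> b * 1" if "a \<in> space \<pi>" for a
      unfolding abs_mult using p[OF that] bounds[of a] that by (intro mult_mono) (auto simp: b_def sp)
    then show "AE a in \<pi>. norm (\<Phi> a * p a) \<le> b" by (intro AE_I2) simp
  qed simp
  have "(\<integral>a. \<Phi> a * p a \<partial>\<pi>) \<le> (\<integral>a. u * p a \<partial>\<pi>)"
    using p bounds by (intro integral_mono i\<Phi>p integrable_mult_right ip mult_right_mono) (auto simp: sp)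
  then show "ereal (cond_exp_data \<Phi> \<pi> D B) \<le> ereal u"
    using pos by (simp add: cond_exp_data_def data_prob_def p_def divide_le_eq)
qed

theorem theorem3p2:
  fixes G :: "('x::topological_space \<Rightarrow> real) topology"
    and A :: "'x scenario set"
    and \<Psi> :: "'x scenario \<Rightarrow> 'q::topological_space"
    and \<Phi> :: "'x scenario \<Rightarrow> real"
    and DM :: "('x scenario \<Rightarrow> 'd::metric_space measure) set"
    and d :: 'd
    and \<QQ> :: "'q measure set"
    and Q :: "'q measure"
    and \<DD> :: "'x scenario \<Rightarrow> 'd measure"
    and h :: "real \<Rightarrow> real"
    and \<tau> \<delta> \<epsilon> \<epsilon>' \<delta>' :: real
  assumes "metrizable_space (euclidean :: 'x topology)"
    and "topspace G \<subseteq> borel_measurable borel"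
    and "A \<subseteq> topspace G \<times> borel_probs euclidean"
    and "suslin_space (scenario_topology G A)"
    and "metrizable_space (euclidean :: 'q topology)"
    and "separable_space (euclidean :: 'q topology)"
    and "\<Psi> \<in> borel_of (scenario_topology G A) \<rightarrow>\<^sub>M borel"
    and "\<Phi> \<in> borel_measurable (borel_of (scenario_topology G A))"
    and "\<bar>upper_val \<Phi> A\<bar> \<noteq> \<infinity>"
    and "\<bar>lower_val \<Phi> A\<bar> \<noteq> \<infinity>"
    and "\<forall>D\<in>DM. data_map (scenario_topology G A) D"
    and "\<QQ> \<subseteq> borel_probs euclidean"
    and "\<forall>\<nu>\<in>\<QQ>. supp \<nu> \<subseteq> \<Psi> ` A"
    and "0 \<le> \<tau>"
    and "Q \<in> \<QQ>" and "\<DD> \<in> DM"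
    and "continuous_on {0..} h" and "mono_on {0..} h" and "h 0 = 0"
    and "\<And>r. 0 < r \<Longrightarrow> universally_measurable (fibre_min_data A \<Psi> \<DD> (ball d r))"
    and "\<And>r. 0 < r \<Longrightarrow>
           measure (completion Q) {q. fibre_min_data A \<Psi> \<DD> (ball d r) q \<le> ereal \<tau>} \<ge> 1 - h r"
    and "0 < \<delta>" and "0 \<le> \<epsilon>" and "0 < \<epsilon>'" and "0 < \<delta>'"
    and "universally_measurable (fibre_sup A \<Psi> \<Phi> \<DD> (ball d \<delta>) \<epsilon>)"
    and "measure (completion Q)
           {q. fibre_sup A \<Psi> \<Phi> \<DD> (ball d \<delta>) \<epsilon> q > upper_val \<Phi> A - ereal \<delta>'} \<ge> \<epsilon>'"
    and "upper_val \<Phi> A \<noteq> lower_val \<Phi> A \<Longrightarrow>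
           ereal (h \<delta> + \<tau>) \<le> ereal (\<epsilon> * \<delta>' * \<epsilon>') / (upper_val \<Phi> A - lower_val \<Phi> A)"
  shows "upper_val \<Phi> A - ereal (2 * \<delta>') \<le> upper_post \<Phi> (priors_over (scenario_topology G A) \<Psi> \<QQ>) DM (ball d \<delta>)
       \<and> upper_post \<Phi> (priors_over (scenario_topology G A) \<Psi> \<QQ>) DM (ball d \<delta>) \<le> upper_val \<Phi> A"
proof -
  let ?T = "scenario_topology G A" and ?B = "ball d \<delta>"
  let ?PR = "priors_over ?T \<Psi> \<QQ>"
  note suslin = assms(4) and met = assms(5) and sep = assms(6) and \<Psi> = assms(7) and \<Phi> = assms(8)
  have top: "topspace ?T = A" using assms(3) by (auto simp: topspace_weak_star)
  obtain u where u: "upper_val \<Phi> A = ereal u" using assms(9) by auto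
  obtain l where l: "lower_val \<Phi> A = ereal l" using assms(10) by auto
  have bounds: "l \<le> \<Phi> a \<and> \<Phi> a \<le> u" if "a \<in> topspace ?T" for a
  proof -
    have "a \<in> A" using that unfolding top .
    then have "ereal (\<Phi> a) \<le> upper_val \<Phi> A" "lower_val \<Phi> A \<le> ereal (\<Phi> a)"
      unfolding upper_val_def lower_val_def by (auto intro: SUP_upper INF_lower)
    then show ?thesis by (simp add: u l)
  qed
  define p where "p = (\<lambda>a. measure (\<DD> a) ?B)"
  have DD: "data_map ?T \<DD>" using assms(11,16) by blast
  have p: "p \<in> borel_measurable (borel_of ?T)" using DD by (simp add: data_map_def p_def)
  have p01: "0 \<le> p a \<and> p a \<le> 1" if "a \<in> topspace ?T" for a
  proof -
    have "prob_space (\<DD> a)" using DD that by (simp add: data_map_def borel_probs_def)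
    then show ?thesis by (simp add: p_def prob_space.prob_le_1)
  qed
  have Q: "Q \<in> borel_probs euclidean" using assms(12,15) by blast
  have supp: "supp Q \<subseteq> \<Psi> ` topspace ?T" using assms(13,15) unfolding top by blast
  interpret Q: prob_space Q using borel_probsD(1)[OF Q] .
  interpret M: prob_space "completion Q" by (rule prob_spaceI) (simp add: Q.emeasure_space_1)
  have ne: "\<exists>a0. a0 \<in> topspace ?T"
  proof (rule ccontr)
    assume "\<not> ?thesis"
    then have "A = {}" using top by auto
    then show False using assms(9) by (simp add: upper_val_def bot_ereal_def)
  qed
  have image_meas: "\<Psi> ` C \<in> sets (completion Q)" if "C \<in> sets (borel_of ?T)" for C
    using ne borel_section_completion[OF suslin _ met sep \<Psi> that Q.finite_measure_axioms borel_probsD(2)[OF Q]]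
    by metis
  have good: "\<epsilon>' \<le> measure (completion Q) (\<Psi> ` {a \<in> topspace ?T. \<epsilon> < p a \<and> u - \<delta>' < \<Phi> a})"
  proof -
    have "{q. fibre_sup A \<Psi> \<Phi> \<DD> ?B \<epsilon> q > upper_val \<Phi> A - ereal \<delta>'}
        \<subseteq> \<Psi> ` {a \<in> topspace ?T. \<epsilon> < p a \<and> u - \<delta>' < \<Phi> a}"
      unfolding top by (auto simp: fibre_sup_def fibre_def p_def u less_SUP_iff)
    moreover have "{a \<in> space (borel_of ?T). \<epsilon> < p a \<and> u - \<delta>' < \<Phi> a} \<in> sets (borel_of ?T)"
      using p \<Phi> by measurable
    ultimately show ?thesis
      using assms(27) by (intro order_trans[OF _ M.finite_measure_mono[OF _ image_meas]]) simp_all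
  qed
  have small: "1 - h \<delta> \<le> measure (completion Q) (\<Psi> ` {a \<in> topspace ?T. p a < \<tau> + \<eta>})" if "0 < \<eta>" for \<eta>
  proof -
    have "{q. fibre_min_data A \<Psi> \<DD> ?B q \<le> ereal \<tau>} \<subseteq> \<Psi> ` {a \<in> topspace ?T. p a < \<tau> + \<eta>}"
    proof
      fix q assume "q \<in> {q. fibre_min_data A \<Psi> \<DD> ?B q \<le> ereal \<tau>}"
      then have "fibre_min_data A \<Psi> \<DD> ?B q \<le> ereal \<tau>" by simp
      also have "ereal \<tau> < ereal (\<tau> + \<eta>)" using that by simp
      finally show "q \<in> \<Psi> ` {a \<in> topspace ?T. p a < \<tau> + \<eta>}"
        unfolding top by (auto simp: fibre_min_data_def fibre_def p_def INF_less_iff)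
    qed
    moreover have "{a \<in> space (borel_of ?T). p a < \<tau> + \<eta>} \<in> sets (borel_of ?T)"
      using p by measurable
    ultimately show ?thesis
      using assms(21)[OF assms(22)]
      by (intro order_trans[OF _ M.finite_measure_mono[OF _ image_meas]]) simp_all
  qed
  have key: "(u - l) * (h \<delta> + \<tau>) \<le> \<epsilon> * \<delta>' * \<epsilon>'"
  proof (cases "u = l")
    case True
    then show ?thesis using assms(23-25) by simp
  next
    case False
    obtain a0 where "a0 \<in> topspace ?T" using ne by blast
    then have "l \<le> u" using bounds by force
    with False have lu: "0 < u - l" by simp
    have "ereal (h \<delta> + \<tau>) \<le> ereal (\<epsilon> * \<delta>' * \<epsilon>') / (ereal u - ereal l)"
      using assms(28) False unfolding u l by simp
    then have "h \<delta> + \<tau> \<le> \<epsilon> * \<delta>' * \<epsilon>' / (u - l)" using lu by simp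
    then show ?thesis using lu by (simp add: pos_le_divide_eq mult.commute)
  qed
  have "ereal (u - 2 * \<delta>') \<le> upper_post \<Phi> ?PR DM ?B"
  proof (rule ereal_le_epsilon2)
    fix e :: real assume "0 < e"
    obtain \<pi> where \<pi>: "\<pi> \<in> borel_probs ?T" "distr \<pi> borel \<Psi> = Q" "0 < (\<integral>a. p a \<partial>\<pi>)"
      "u - 2 * \<delta>' - e \<le> (\<integral>a. \<Phi> a * p a \<partial>\<pi>) / (\<integral>a. p a \<partial>\<pi>)"
      using near_optimal_prior[OF suslin met sep \<Psi> \<Phi> p Q supp bounds p01 good small key
          assms(14,23,24,25) \<open>0 < e\<close>] by blast
    have "\<pi> \<in> ?PR" using \<pi>(1,2) assms(15) by (simp add: priors_over_def)
    moreover have "0 < data_prob \<pi> \<DD> ?B" using \<pi>(3) by (simp add: data_prob_def p_def)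
    ultimately have "ereal (cond_exp_data \<Phi> \<pi> \<DD> ?B) \<le> upper_post \<Phi> ?PR DM ?B"
      unfolding upper_post_def using assms(16) by (intro Sup_upper) blast
    moreover have "ereal (u - 2 * \<delta>') \<le> ereal (cond_exp_data \<Phi> \<pi> \<DD> ?B) + ereal e"
      using \<pi>(4) by (simp add: cond_exp_data_def data_prob_def p_def)
    ultimately show "ereal (u - 2 * \<delta>') \<le> upper_post \<Phi> ?PR DM ?B + ereal e"
      by (meson add_right_mono order_trans)
  qed
  moreover have "upper_post \<Phi> ?PR DM ?B \<le> ereal u"
    using upper_post_le[OF \<Phi> bounds assms(11)] by (simp add: priors_over_def)
  ultimately show ?thesis by (simp add: u)
qed

end
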